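(* Let $2 \leq s \leq n$ be integers, and let $\mathbb{F}_q$ be a finite definite field (i.e. $q \equiv 3 \pmod 4$) with $q = p^k$, $p$ prime. Let $\epsilon, \epsilon' \in \{\pm1\}^n$ be sign patterns satisfying $\epsilon_1 = \dots = \epsilon_s = \epsilon'_1 = \dots = \epsilon'_s = 1$. Then for a given function $f : \mathbb{F}_q \to \mathbb{F}_q$ the following are equivalent: (1) The entrywise transform $f[-]$ sends $LPM_n^{\mathbb{F}_q}(\epsilon')$ into $LPM_n^{\mathbb{F}_q}(\epsilon)$. (2) The sign patterns are equal, and $f$ is a positive multiple of a power of the Frobenius: $\epsilon' = \epsilon$, and $f \equiv c \cdot \mathrm{Frob}_p^\ell$ for some $0 \leq \ell \leq k-1$ and $c \in \mathbb{F}_q^+$. Moreover, every such map $f[-] \equiv c\cdot \mathrm{Frob}_p^\ell[-]$ is compatible with the Cholesky maps $\Psi_{A_\epsilon}^{\pm1}$ (for $A_\epsilon \in LPM_n^{\mathbb{F}_q}(\epsilon)$) in the following sense: for all $A \in LPM_n^{\mathbb{F}_q}(\epsilon)$, $L \in \mathbf{L}_n^{\mathbb{F}_q^+}$ and $0 \leq \ell \leq k-1$, we have $$\Psi_{A_\epsilon}^{-1}\big(c\cdot \mathrm{Frob}_p^\ell[A]\big) = \mathrm{Frob}_p^\ell\Big[\Psi^{-1}_{c\cdot \mathrm{Frob}_p^{\ell}[A_\epsilon]}(A)\Big] = \sqrt{c}\cdot \mathrm{Frob}_p^\ell\Big[\Psi^{-1}_{\mathrm{Frob}_p^{\ell}[A_\epsilon]}(A)\Big]$$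 and $$c\cdot \mathrm{Frob}_p^\ell\big[\Psi_{A_\epsilon}(L)\big] = \Psi_{c\cdot \mathrm{Frob}_p^\ell[A_\epsilon]}\big(\mathrm{Frob}_p^\ell[L]\big) = \Psi_{\mathrm{Frob}_p^\ell[A_\epsilon]}\big(\sqrt{c}\cdot \mathrm{Frob}_p^\ell[L]\big),$$ where $\sqrt{c}$ denotes the unique $d \in \mathbb{F}_q^+$ such that $d^2 = c$. In particular, if $c=1$ and the chosen $A_\epsilon$ is $\mathbb{D}_\epsilon$, then $\Psi_{\mathbb{D}_\epsilon}^{\pm1} \circ \mathrm{Frob}_p = \mathrm{Frob}_p \circ \Psi_{\mathbb{D}_\epsilon}^{\pm1}$, i.e., $$\Psi_{\mathbb{D}_\epsilon}(\mathrm{Frob}_p[M_+]) = \mathrm{Frob}_p[\Psi_{\mathbb{D}_\epsilon}(M_+)] \quad\text{and}\quad \Psi_{\mathbb{D}_\epsilon}^{-1}(\mathrm{Frob}_p[M_-]) = \mathrm{Frob}_p[\Psi_{\mathbb{D}_\epsilon}^{-1}(M_-)]$$ for all $M_+ \in \mathbf{L}_n^{\mathbb{F}_q^+}$ and all $M_- \in LPM_n^{\mathbb{F}_q}(\epsilon)$.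
   Context: An element of $\mathbb{F}_q^\times$ is positive if it is a nonzero square, and negative otherwise; $\mathbb{F}_q^+$ is the set of positive elements. The quadratic character $\chi$ takes the value $1$ on positive elements, $-1$ on negative elements, and $\chi(0)=0$. In a definite field ($q \equiv 3 \pmod 4$), $-1$ is negative. For $\epsilon \in \{\pm1\}^n$, $LPM_n^{\mathbb{F}_q}(\epsilon)$ is the set of symmetric matrices $A \in \mathbb{F}_q^{n\times n}$ such that for each $k=1,\dots,n$ the $k\times k$ leading principal minor of $A$ has quadratic character $\epsilon_k$. For $f:\mathbb{F}_q\to\mathbb{F}_q$, the entrywise transform $f[-]$ is $f[A] := (f(a_{ij}))_{i,j}$ for $A = (a_{ij}) \in \mathbb{F}_q^{n\times n}$. $\mathrm{Frob}_p(x) = x^p$ is the Frobenius automorphism of $\mathbb{F}_q$, and $\mathrm{Frob}_p^\ell$ is its $\ell$-fold composition. $\mathbf{L}_n^{\mathbb{F}_q^+}$ is the set of lower triangular matrices in $\mathbb{F}_q^{n\times n}$ with all diagonal entries positive. For $A_\epsilon \in LPM_n^{\mathbb{F}_q}(\epsilon)$ over a definite field, $\Psi_{A_\epsilon} : \mathbf{L}_n^{\mathbb{F}_q^+} \to LPM_n^{\mathbb{F}_q}(\epsilon)$ is the map $L \mapsto L A_\epsilon L^T$, which is a bijection; $\Psi_{A_\epsilon}^{-1}$ is its inverse. $\mathbb{D}_\epsilon := \mathrm{diag}(\omega_1, \omega_1\omega_2, \omega_2\omega_3, \dots, \omega_{n-1}\omega_n) \in \mathbb{F}_q^{n\times n}$,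 where $\omega_k \in \{1,-1\} \subset \mathbb{F}_q$ is $1$ if $\epsilon_k = 1$ and $-1$ if $\epsilon_k = -1$; it belongs to $LPM_n^{\mathbb{F}_q}(\epsilon)$.
   Formalization: The first displayed chain (for the inverse Cholesky map) is false as printed (q=7, A=A_ε=I, ℓ=0, c=2); it is proved with the subscripts c·Frob^ℓ[A_ε] and Frob^ℓ[A_ε] replaced by the entrywise inverse maps (c·Frob^ℓ)^{-1}[A_ε] and (Frob^ℓ)^{-1}[A_ε]. *)

theory Defs
  imports
    "HOL-Library.FuncSet"
    "HOL-Library.Cardinality"
    "HOL-Computational_Algebra.Primes"
    "HOL-Computational_Algebra.Nth_Powers"
    "Jordan_Normal_Form.Determinant"
    "Jordan_Normal_Form.DL_Submatrix"
begin

definition positives :: "'a::finite_field set" where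
  "positives = {x. x \<noteq> 0 \<and> is_square x}"

definition quad_char :: "'a::finite_field \<Rightarrow> int" where
  "quad_char x = (if x = 0 then 0 else if x \<in> positives then 1 else -1)"

text \<open>
  Sign patterns of length \<open>n\<close> are functions on \<open>{1..n}\<close> (1-based, as the sizes of the
  leading principal minors). They are taken extensional, so that equality of functions is
  equality of patterns.
\<close>

definition sign_patterns :: "nat \<Rightarrow> (nat \<Rightarrow> int) set" where
  "sign_patterns n = {1..n} \<rightarrow>\<^sub>E {1, -1}"

definition leading_minor :: "'a::comm_ring_1 mat \<Rightarrow> nat \<Rightarrow> 'a" where
  "leading_minor A k = det (submatrix A {..<k} {..<k})"

definition LPM :: "nat \<Rightarrow> (nat \<Rightarrow> int) \<Rightarrow> 'a::finite_field mat set" where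
  "LPM n \<epsilon> = {A \<in> carrier_mat n n. transpose_mat A = A \<and>
     (\<forall>k\<in>{1..n}. quad_char (leading_minor A k) = \<epsilon> k)}"

definition frob :: "nat \<Rightarrow> 'a::finite_field \<Rightarrow> 'a" where
  "frob p x = x ^ p"

definition pos_lower :: "nat \<Rightarrow> 'a::finite_field mat set" where
  "pos_lower n = {L \<in> carrier_mat n n.
     (\<forall>i<n. \<forall>j<n. i < j \<longrightarrow> L $$ (i,j) = 0) \<and> (\<forall>i<n. L $$ (i,i) \<in> positives)}"

definition cholesky :: "'a::finite_field mat \<Rightarrow> 'a mat \<Rightarrow> 'a mat" where
  "cholesky B L = L * B * transpose_mat L"

text \<open>
  If \<open>CARD('a) mod 4 = 3\<close> and \<open>B \<in> LPM n \<epsilon>\<close>, then \<open>cholesky B\<close> is a bijection from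
  \<open>pos_lower n\<close> onto \<open>LPM n \<epsilon>\<close>; the following is its inverse there.

  For a field automorphism \<open>\<phi>\<close>, applied entrywise, \<open>\<phi>(cholesky B L) = cholesky (\<phi> B) (\<phi> L)\<close>.
  Hence \<open>cholesky_inv n B (\<phi> A) = \<phi> (cholesky_inv n (\<phi>\<^sup>-\<^sup>1 B) A)\<close>: moving \<open>\<phi>\<close> out of the argument
  replaces the base point \<open>B\<close> by its preimage, not by its image.
\<close>

definition cholesky_inv :: "nat \<Rightarrow> 'a::finite_field mat \<Rightarrow> 'a mat \<Rightarrow> 'a mat" where
  "cholesky_inv n B = inv_into (pos_lower n) (cholesky B)"

definition pos_sqrt :: "'a::finite_field \<Rightarrow> 'a" where
  "pos_sqrt c = (THE d. d \<in> positives \<and> d ^ 2 = c)"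

definition sign_elt :: "(nat \<Rightarrow> int) \<Rightarrow> nat \<Rightarrow> 'a::finite_field" where
  "sign_elt \<epsilon> k = (if \<epsilon> k = 1 then 1 else -1)"

text \<open>
  Matrix indices start at 0: the diagonal entry with index \<open>i > 0\<close> is
  \<open>\<omega>\<^sub>i \<omega>\<^sub>i\<^sub>+\<^sub>1\<close> for the 1-based signs \<open>\<omega>\<close>.
\<close>

definition sign_diag :: "nat \<Rightarrow> (nat \<Rightarrow> int) \<Rightarrow> 'a::finite_field mat" where
  "sign_diag n \<epsilon> =
     mat_diag n (\<lambda>i. if i = 0 then sign_elt \<epsilon> 1 else sign_elt \<epsilon> i * sign_elt \<epsilon> (i + 1))"

end

theory Submission
  imports Defs "HOL-Number_Theory.Residues"
begin

text \<open>
  Only the leading \<open>2 \<times> 2\<close> blocks matter for the implication from (1) to (2). They show that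
  \<open>g = f / f 1\<close> permutes the positive elements and satisfies \<open>g x - g y \<in> positives\<close> iff
  \<open>x - y \<in> positives\<close> there. Comparing the sets \<open>{y \<in> positives. y - u \<in> positives}\<close>, whose size does
  not depend on the positive element \<open>u\<close>, gives \<open>g (b\<^sup>2) = g a * g (b\<^sup>2 / a)\<close>, so \<open>g\<close> is
  multiplicative on the positive elements; counting the positive \<open>y\<close> with \<open>c - y\<close> positive (one more
  for negative than for positive \<open>c\<close>) shows that \<open>g\<close> maps negative elements to negative ones and is odd.

  Hence \<open>g x = x ^ e\<close> and \<open>(1 + x ^ e) ^ m = (1 + x) ^ m\<close> with \<open>m = (q - 1) / 2\<close>. Comparing
  coefficients, multiplication by \<open>e\<close> modulo \<open>q - 1\<close> maps every \<open>j\<close> for which \<open>p\<close> does not divide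
  \<open>m choose j\<close> into \<open>{0..m}\<close>. All base-\<open>p\<close> digits of \<open>m\<close> are \<open>(p - 1) / 2\<close>, so by Lucas' theorem one
  may build \<open>m\<close> digit by digit along such \<open>j\<close>, which bounds the sum of the residues of \<open>e * p ^ l\<close> for
  \<open>l < k\<close> by \<open>(q - 1) / (p - 1)\<close>. That sum is \<open>(q - 1) / (p - 1)\<close> times the base-\<open>p\<close> digit sum
  of \<open>e\<close>, so \<open>e\<close> is a power of \<open>p\<close>.

  The remaining identities follow from uniqueness in the Cholesky decomposition, since a field
  automorphism commutes with \<open>L * B * transpose_mat L\<close>.
\<close>

section \<open>Positive elements of a definite field\<close>

locale definite_field =
  fixes ty :: "'a::finite_field itself"
  assumes card_mod_4: "CARD('a) mod 4 = 3"
begin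

text \<open>The exponent of Euler's criterion: \<open>x ^ half\<close> is the quadratic character of
  \<open>x\<close> with values in the field. Its oddness says that -1 is not a square.\<close>

definition half :: nat where "half = (CARD('a) - 1) div 2"

lemma card_eq_half: "CARD('a) = 2 * half + 1"
  unfolding half_def using card_mod_4 by presburger

lemma odd_half: "odd half"
  unfolding half_def using card_mod_4 by presburger

lemma half_pos: "0 < half"
  using odd_half by (metis gr0I even_zero)

lemma power_card_minus_1:
  assumes "(x::'a) \<noteq> 0" shows "x ^ (2 * half) = 1"
proof -
  have "x ^ (2 * half) * x = x"
    using finite_field_power_card_eq_same[of x] card_eq_half by (simp add: power_add mult.commute)
  then show ?thesis using assms by simp
qed

lemma one_neq_minus_one: "(1::'a) \<noteq> -1"
proof
  assume "(1::'a) = -1"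
  then have "of_nat 2 = (0::'a)"
    by (metis add.right_inverse of_nat_numeral one_add_one)
  then have "CHAR('a) dvd 2" by (simp only: of_nat_eq_0_iff_char_dvd)
  then have "CHAR('a) = 2" by (meson CHAR_prime primes_dvd_imp_eq two_is_prime_nat)
  moreover have "CHAR('a) dvd CARD('a)" by (rule CHAR_dvd_CARD)
  ultimately show False using card_eq_half by simp
qed

lemma power_half_cases:
  assumes "(x::'a) \<noteq> 0" shows "x ^ half = 1 \<or> x ^ half = -1"
proof -
  have "(x ^ half)\<^sup>2 = 1"
    using power_card_minus_1[OF assms] by (simp add: power_mult[symmetric] mult.commute)
  then show ?thesis by (simp add: power2_eq_1_iff)
qed

text \<open>Euler's criterion. For the converse, \<open>half\<close> is odd, so
  \<open>x ^ ((half + 1) div 2)\<close> is an explicit square root of any \<open>x\<close> with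
  \<open>x ^ half = 1\<close>.\<close>

lemma positives_iff: "(x::'a) \<in> positives \<longleftrightarrow> x ^ half = 1"
proof
  assume "x \<in> positives"
  then obtain y where y: "x = y\<^sup>2" "x \<noteq> 0" by (auto simp: positives_def is_nth_power_def)
  then have "y \<noteq> 0" by auto
  then show "x ^ half = 1" using power_card_minus_1[of y] y by (simp add: power_mult)
next
  assume x: "x ^ half = 1"
  then have "x \<noteq> 0" using half_pos by (metis power_0_left zero_neq_one neq0_conv)
  moreover have "x = (x ^ ((half + 1) div 2))\<^sup>2"
  proof -
    have "x = x ^ (half + 1)" using x by simp
    also have "half + 1 = ((half + 1) div 2) * 2" using odd_half by presburger
    finally show ?thesis by (simp add: power_mult)
  qed
  ultimately show "x \<in> positives" unfolding positives_def is_nth_power_def by blast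
qed

lemma zero_not_positive [simp]: "(0::'a) \<notin> positives"
  by (simp add: positives_def)

lemma one_positive [simp]: "(1::'a) \<in> positives"
  by (simp add: positives_iff)

lemma power_half_not_positive:
  assumes "(x::'a) \<noteq> 0" "x \<notin> positives" shows "x ^ half = -1"
  using power_half_cases assms positives_iff by blast

text \<open>An odd exponent lets the sign through:
  \<open>(- x) ^ half = - (x ^ half)\<close>.\<close>

lemma uminus_positive_iff:
  assumes "(x::'a) \<noteq> 0" shows "- x \<in> positives \<longleftrightarrow> x \<notin> positives"
  using power_half_cases[OF assms] odd_half one_neq_minus_one
  by (metis add.inverse_inverse positives_iff power_minus_odd)

lemma positives_mult_iff:
  assumes "(x::'a) \<in> positives" shows "x * y \<in> positives \<longleftrightarrow> y \<in> positives"
  using assms by (simp add: positives_iff power_mult_distrib)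

lemma positives_mult_iff2:
  assumes "(x::'a) \<in> positives" shows "y * x \<in> positives \<longleftrightarrow> y \<in> positives"
  using positives_mult_iff[OF assms, of y] by (simp add: mult.commute[of y x])

lemma positives_power: "(x::'a) \<in> positives \<Longrightarrow> x ^ i \<in> positives"
  by (induction i) (simp_all add: positives_mult_iff)

lemma positives_inverse_iff: "inverse (x::'a) \<in> positives \<longleftrightarrow> x \<in> positives"
  by (metis inverse_1 inverse_eq_iff_eq positives_iff power_inverse)

lemma positives_divide_iff:
  assumes "(x::'a) \<in> positives" shows "y / x \<in> positives \<longleftrightarrow> y \<in> positives"
  using positives_mult_iff2[of "inverse x" y] assms
  by (simp add: positives_inverse_iff divide_inverse)

lemma square_positive: "(x::'a) \<noteq> 0 \<Longrightarrow> x\<^sup>2 \<in> positives"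
  by (auto simp: positives_def)

lemma positive_not_zero: "(x::'a) \<in> positives \<Longrightarrow> x \<noteq> 0"
  by (simp add: positives_def)

lemma positive_square_inj:
  assumes "(x::'a) \<in> positives" "y \<in> positives" "x\<^sup>2 = y\<^sup>2" shows "x = y"
proof -
  have "x = y \<or> x = - y" using assms(3) by (simp add: power2_eq_iff)
  then show ?thesis using assms(1,2) uminus_positive_iff positive_not_zero by blast
qed

lemma ex1_positive_sqrt:
  assumes "(c::'a) \<in> positives" shows "\<exists>!d. d \<in> positives \<and> d\<^sup>2 = c"
proof -
  obtain y where y: "c = y\<^sup>2" "y \<noteq> 0" using assms by (auto simp: positives_def is_nth_power_def)
  show ?thesis
  proof (rule ex_ex1I)
    show "\<exists>d. d \<in> positives \<and> d\<^sup>2 = c"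
    proof (cases "y \<in> positives")
      case False
      then have "- y \<in> positives" "(- y)\<^sup>2 = c" using uminus_positive_iff[OF y(2)] y by auto
      then show ?thesis by blast
    qed (use y in blast)
  next
    fix d e assume "d \<in> positives \<and> d\<^sup>2 = c" "e \<in> positives \<and> e\<^sup>2 = c"
    then show "d = e" using positive_square_inj[of d e] by simp
  qed
qed

lemma pos_sqrt:
  assumes "(c::'a) \<in> positives" shows "pos_sqrt c \<in> positives" "(pos_sqrt c)\<^sup>2 = c"
proof -
  have "pos_sqrt c \<in> positives \<and> (pos_sqrt c)\<^sup>2 = c"
    unfolding pos_sqrt_def by (rule theI'[OF ex1_positive_sqrt[OF assms]])
  then show "pos_sqrt c \<in> positives" "(pos_sqrt c)\<^sup>2 = c" by auto
qed

lemma quad_char_eq_1_iff: "quad_char (x::'a) = 1 \<longleftrightarrow> x \<in> positives"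
  by (auto simp: quad_char_def)

lemma quad_char_mult: "quad_char ((x::'a) * y) = quad_char x * quad_char y"
proof (cases "x = 0 \<or> y = 0")
  case False
  then have "x * y \<in> positives \<longleftrightarrow> (x \<in> positives \<longleftrightarrow> y \<in> positives)"
    using power_half_cases[of x] power_half_cases[of y] one_neq_minus_one
    by (auto simp: positives_iff power_mult_distrib)
  then show ?thesis using False by (auto simp: quad_char_def)
qed (auto simp: quad_char_def)

lemma quad_char_positive_mult:
  "(c::'a) \<in> positives \<Longrightarrow> quad_char (c * x) = quad_char x"
  by (simp add: quad_char_mult quad_char_eq_1_iff)

lemma card_positives: "card (positives :: 'a set) = half"
proof -
  have "UNIV - {0} = positives \<union> uminus ` (positives :: 'a set)"
  proof -
    have "x \<in> uminus ` positives" if "x \<noteq> 0" "x \<notin> positives" for x :: 'a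
      using that uminus_positive_iff[of x] by (intro image_eqI[of x uminus "- x"]) auto
    then show ?thesis using positive_not_zero by fastforce
  qed
  moreover have "positives \<inter> uminus ` (positives :: 'a set) = {}"
    using uminus_positive_iff positive_not_zero by blast
  ultimately have "card (UNIV - {0::'a}) = card (positives :: 'a set) + card (uminus ` (positives :: 'a set))"
    by (metis card_Un_disjoint finite)
  also have "card (uminus ` (positives :: 'a set)) = card (positives :: 'a set)"
    by (rule card_image) simp
  also have "card (UNIV - {0::'a}) = 2 * half" using card_eq_half by (simp add: card_Diff_singleton)
  finally show ?thesis by simp
qed

end

section \<open>Functions preserving positive two-by-two minors\<close>

context definite_field
begin

text \<open>The relation \<open>y - u \<in> positives\<close> is a tournament on the positive
  elements. Scaling by \<open>u\<close> is an automorphism of it that moves 1 to \<open>u\<close>,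
  so all degrees agree.\<close>

lemma card_positives_above:
  assumes "(u::'a) \<in> positives"
  shows "card {y \<in> positives. y - u \<in> positives} = card {y \<in> positives. y - (1::'a) \<in> positives}"
proof -
  have "{y \<in> positives. y - u \<in> positives} = (\<lambda>y. u * y) ` {y \<in> positives. y - 1 \<in> positives}"
  proof (intro equalityI subsetI)
    fix y assume y: "y \<in> {y \<in> positives. y - u \<in> positives}"
    have "y / u - 1 = (y - u) / u" using positive_not_zero[OF assms] by (simp add: field_simps)
    then show "y \<in> (\<lambda>y. u * y) ` {y \<in> positives. y - 1 \<in> positives}"
      using y assms positive_not_zero[OF assms]
      by (intro image_eqI[of _ _ "y / u"]) (auto simp: positives_divide_iff)
  next
    fix y assume "y \<in> (\<lambda>y. u * y) ` {y \<in> positives. y - 1 \<in> positives}"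
    then obtain z where z: "y = u * z" "z \<in> positives" "z - 1 \<in> positives" by auto
    have "y - u = u * (z - 1)" using z by (simp add: algebra_simps)
    then show "y \<in> {y \<in> positives. y - u \<in> positives}"
      using z assms by (simp add: positives_mult_iff)
  qed
  moreover have "inj_on (\<lambda>y. u * y) X" for X
    using positive_not_zero[OF assms] by (auto simp: inj_on_def)
  ultimately show ?thesis by (simp add: card_image)
qed

text \<open>Scaling by \<open>u\<close> again, now for arbitrary \<open>c\<close>: the count depends
  only on whether \<open>c\<close> is zero, positive or negative.\<close>

lemma card_positives_below_mult:
  assumes "(u::'a) \<in> positives"
  shows "card {y \<in> positives. u * c - y \<in> positives} = card {y \<in> positives. c - y \<in> positives}"
proof -
  have "{y \<in> positives. u * c - y \<in> positives} = (\<lambda>y. u * y) ` {y \<in> positives. c - y \<in> positives}"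
  proof (intro equalityI subsetI)
    fix y assume y: "y \<in> {y \<in> positives. u * c - y \<in> positives}"
    have "c - y / u = (u * c - y) / u" using positive_not_zero[OF assms] by (simp add: field_simps)
    then show "y \<in> (\<lambda>y. u * y) ` {y \<in> positives. c - y \<in> positives}"
      using y assms positive_not_zero[OF assms]
      by (intro image_eqI[of _ _ "y / u"]) (auto simp: positives_divide_iff)
  next
    fix y assume "y \<in> (\<lambda>y. u * y) ` {y \<in> positives. c - y \<in> positives}"
    then obtain z where z: "y = u * z" "z \<in> positives" "c - z \<in> positives" by auto
    have "u * c - y = u * (c - z)" using z by (simp add: algebra_simps)
    then show "y \<in> {y \<in> positives. u * c - y \<in> positives}"
      using z assms by (simp add: positives_mult_iff)
  qed
  moreover have "inj_on (\<lambda>y. u * y) X" for X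
    using positive_not_zero[OF assms] by (auto simp: inj_on_def)
  ultimately show ?thesis by (simp add: card_image)
qed

lemma diff_positive_iff:
  assumes "(x::'a) \<noteq> y" shows "x - y \<in> positives \<longleftrightarrow> y - x \<notin> positives"
  using uminus_positive_iff[of "y - x"] assms by simp

text \<open>Inversion exchanges \<open>A\<close> and \<open>C\<close>, which partition the positive
  elements other than 1, so \<open>half = 2 * card A + 1\<close>. Shifting by one identifies
  \<open>C\<close> with \<open>E\<close>, and \<open>E\<close>, \<open>F\<close> partition the
  positive elements, so \<open>card F = half - card A = card A + 1\<close>.\<close>

lemma card_positives_below_minus_one:
  "card {y \<in> positives. - 1 - (y::'a) \<in> positives} = card {y \<in> positives. (1::'a) - y \<in> positives} + 1"
proof -
  define A where "A = {y \<in> positives. (1::'a) - y \<in> positives}"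
  define C where "C = {y \<in> positives. y - (1::'a) \<in> positives}"
  define E where "E = {y \<in> positives. 1 + (y::'a) \<in> positives}"
  define F where "F = {y \<in> positives. - 1 - (y::'a) \<in> positives}"
  have inv: "inverse y - 1 = (1 - y) / y" "1 - inverse y = (y - 1) / y" if "y \<in> positives" for y :: 'a
    using positive_not_zero[OF that] by (simp_all add: divide_inverse algebra_simps)
  have CA: "inverse y \<in> A" if "y \<in> C" for y
    using that unfolding A_def C_def by (simp add: inv positives_inverse_iff positives_divide_iff)
  have AC: "inverse y \<in> C" if "y \<in> A" for y
    using that unfolding A_def C_def by (simp add: inv positives_inverse_iff positives_divide_iff)
  have "C = inverse ` A"
  proof (intro equalityI subsetI)
    fix y assume "y \<in> C"
    then show "y \<in> inverse ` A"
      using CA by (intro image_eqI[of _ _ "inverse y"]) simp_all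
  qed (use AC in blast)
  then have AC: "card C = card A" by (simp add: card_image inj_on_def)
  have yy: "1 - y \<in> positives \<longleftrightarrow> y - 1 \<notin> positives" if "y \<noteq> 1" for y :: 'a
    using diff_positive_iff[of 1 y] that by simp
  have n1: "(1::'a) \<notin> A" "(1::'a) \<notin> C" unfolding A_def C_def by simp_all
  have AuC: "positives - {1} = A \<union> C"
  proof (rule Set.set_eqI)
    fix y :: 'a
    show "y \<in> positives - {1} \<longleftrightarrow> y \<in> A \<union> C"
      using yy[of y] n1 by (cases "y = 1") (auto simp: A_def C_def)
  qed
  have AiC: "A \<inter> C = {}"
  proof (rule equals0I)
    fix y assume y: "y \<in> A \<inter> C"
    then have "y \<noteq> 1" using n1 by auto
    then show False using y yy[of y] by (auto simp: A_def C_def)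
  qed
  have "card (positives - {1::'a}) = card A + card C"
    unfolding AuC using AiC by (intro card_Un_disjoint) simp_all
  moreover have "card (positives - {1::'a}) = half - 1"
    by (simp add: card_positives)
  ultimately have P: "card (positives :: 'a set) = 2 * card A + 1"
    using AC half_pos unfolding card_positives by linarith
  have "C = (\<lambda>y. 1 + y) ` E"
  proof (intro equalityI subsetI)
    fix y assume "y \<in> C"
    then show "y \<in> (\<lambda>y. 1 + y) ` E"
      unfolding C_def E_def by (intro image_eqI[of _ _ "y - 1"]) auto
  qed (auto simp: C_def E_def)
  then have CE: "card C = card E" by (simp add: card_image)
  have "- 1 - y \<in> positives \<longleftrightarrow> 1 + y \<notin> positives" if "y \<in> positives" for y :: 'a
  proof -
    have "1 + y \<noteq> 0"
    proof
      assume "1 + y = 0"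
      then have "y = - 1" by (simp add: add_eq_0_iff)
      then have "- (1::'a) \<in> positives" using that by simp
      then show False using uminus_positive_iff[of "1::'a"] by simp
    qed
    then show ?thesis using uminus_positive_iff[of "1 + y"] by simp
  qed
  then have EF: "positives = E \<union> F" "E \<inter> F = {}"
    unfolding E_def F_def by auto
  have "card (positives :: 'a set) = card E + card F"
    unfolding EF(1) using EF(2) by (intro card_Un_disjoint) auto
  then show ?thesis using P AC CE unfolding A_def F_def by simp
qed

end

section \<open>Normalized preservers: multiplicativity, signs and injectivity\<close>

locale normalized_preserver = definite_field ty
  for ty :: "'a::finite_field itself" +
  fixes g :: "'a \<Rightarrow> 'a"
  assumes g_one: "g 1 = 1"
    and g_positive: "a \<in> positives \<Longrightarrow> g a \<in> positives"
    and g_minor: "a \<in> positives \<Longrightarrow> a * c - b\<^sup>2 \<in> positives \<Longrightarrow> g a * g c - (g b)\<^sup>2 \<in> positives"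
begin

text \<open>Test block with rows \<open>(x, y)\<close> and \<open>(y, y)\<close>: its determinant is
  \<open>y * (x - y)\<close>, and that of its image factors in the same way.\<close>

lemma g_order:
  assumes "x \<in> positives" "y \<in> positives" "x - y \<in> positives"
  shows "g x - g y \<in> positives"
proof -
  have "x * y - y\<^sup>2 = y * (x - y)" by (simp add: power2_eq_square algebra_simps)
  then have "g x * g y - (g y)\<^sup>2 \<in> positives"
    using assms by (intro g_minor) (simp_all add: positives_mult_iff)
  also have "g x * g y - (g y)\<^sup>2 = g y * (g x - g y)" by (simp add: power2_eq_square algebra_simps)
  finally show ?thesis using g_positive[OF assms(2)] by (simp add: positives_mult_iff)
qed

text \<open>For distinct elements exactly one of the two differences is positive, so a map that
  preserves the relation also reflects it.\<close>

lemma g_order_iff: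
  assumes "x \<in> positives" "y \<in> positives"
  shows "g x - g y \<in> positives \<longleftrightarrow> x - y \<in> positives"
proof (cases "x = y")
  case False
  have "x - y \<in> positives" if "g x - g y \<in> positives"
  proof (rule ccontr)
    assume "x - y \<notin> positives"
    then have "g y - g x \<in> positives" using diff_positive_iff[OF False] g_order assms by blast
    moreover have "g x \<noteq> g y" using that by auto
    ultimately show False using that diff_positive_iff[of "g x" "g y"] by blast
  qed
  then show ?thesis using g_order assms by blast
qed simp

lemma g_bij: "inj_on g positives" "g ` positives = positives"
proof -
  show "inj_on g positives"
  proof (rule inj_onI, rule ccontr)
    fix x y assume "x \<in> positives" "y \<in> positives" "g x = g y" "x \<noteq> y"
    then show False using diff_positive_iff[of x y] g_order_iff[of x y] g_order_iff[of y x] by auto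
  qed
  then show "g ` positives = positives"
    using g_positive by (intro endo_inj_surj) auto
qed

lemma g_preimage:
  assumes "y \<in> positives" obtains c where "c \<in> positives" "y = g c"
proof -
  have "y \<in> g ` positives" using assms by (simp add: g_bij)
  then obtain c where c: "y = g c" "c \<in> positives" by (rule imageE)
  show ?thesis by (rule that[OF c(2,1)])
qed

text \<open>A nonzero \<open>g 0\<close> would have square \<open>g c\<close> for some positive
  \<open>c\<close>. The block \<open>diag(1, c)\<close>, of determinant \<open>c\<close>, would then
  be sent to a block of determinant 0.\<close>

lemma g_zero: "g 0 = 0"
proof (rule ccontr)
  assume "g 0 \<noteq> 0"
  then obtain c where c: "c \<in> positives" "(g 0)\<^sup>2 = g c"
    by (rule g_preimage[OF square_positive])
  have "g 1 * g c - (g 0)\<^sup>2 \<in> positives" using c by (intro g_minor) auto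
  then show False using c g_one by simp
qed

text \<open>Blocks with rows \<open>(a, b)\<close> and \<open>(b, c)\<close>, with \<open>c\<close>
  varying, show that every positive \<open>y\<close> above \<open>u\<close> lies above
  \<open>v\<close>. Both sets have the same size, hence coincide. If \<open>u \<noteq> v\<close>,
  one of the two lies above the other and therefore above itself, which is absurd.\<close>

lemma g_square_div:
  assumes a: "a \<in> positives" and b: "b \<noteq> 0" "g b \<noteq> 0"
  shows "(g b)\<^sup>2 = g a * g (b\<^sup>2 / a)"
proof -
  define u where "u = g (b\<^sup>2 / a)"
  define v where "v = (g b)\<^sup>2 / g a"
  have a0: "a \<noteq> 0" "g a \<noteq> 0" using positive_not_zero[OF a] positive_not_zero[OF g_positive[OF a]] by simp_all
  have ba: "b\<^sup>2 / a \<in> positives" using a b by (simp add: positives_divide_iff square_positive)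
  have u: "u \<in> positives" unfolding u_def using ba by (rule g_positive)
  have v: "v \<in> positives" unfolding v_def
    using a b by (simp add: positives_divide_iff square_positive g_positive)
  have sub: "y - v \<in> positives" if y: "y \<in> positives" "y - u \<in> positives" for y
  proof -
    obtain c where c: "c \<in> positives" "y = g c" using y(1) by (rule g_preimage)
    then have "c - b\<^sup>2 / a \<in> positives" using y(2) g_order_iff[OF c(1) ba] by (simp add: u_def)
    moreover have "a * c - b\<^sup>2 = a * (c - b\<^sup>2 / a)" using a0 by (simp add: right_diff_distrib)
    ultimately have "g a * g c - (g b)\<^sup>2 \<in> positives"
      using a by (intro g_minor) (simp_all add: positives_mult_iff)
    also have "g a * g c - (g b)\<^sup>2 = g a * (y - v)" using a0 by (simp add: right_diff_distrib v_def c)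
    finally show ?thesis using g_positive[OF a] by (simp add: positives_mult_iff)
  qed
  have eq: "{y \<in> positives. y - u \<in> positives} = {y \<in> positives. y - v \<in> positives}"
  proof (rule card_subset_eq)
    show "{y \<in> positives. y - u \<in> positives} \<subseteq> {y \<in> positives. y - v \<in> positives}"
      using sub by auto
  qed (simp_all add: card_positives_above[OF u] card_positives_above[OF v])
  have "u = v"
  proof (rule ccontr)
    assume "u \<noteq> v"
    then consider "u - v \<in> positives" | "v - u \<in> positives" using diff_positive_iff[of u v] by auto
    then show False
    proof cases
      case 1
      then have "u \<in> {y \<in> positives. y - u \<in> positives}" unfolding eq using u by simp
      then show False by simp
    next
      case 2
      then have "v \<in> {y \<in> positives. y - v \<in> positives}" unfolding eq[symmetric] using v by simp
      then show False by simp
    qed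
  qed
  then show ?thesis using a0 unfolding u_def v_def by (simp add: nonzero_divide_eq_eq mult.commute)
qed

lemma g_square: "b \<noteq> 0 \<Longrightarrow> g b \<noteq> 0 \<Longrightarrow> (g b)\<^sup>2 = g (b\<^sup>2)"
  using g_square_div[of 1 b] g_one by simp

text \<open>With \<open>b\<close> the positive root of \<open>x * y\<close>, the preceding identity
  evaluates \<open>(g b)\<^sup>2\<close> twice, for \<open>a = 1\<close> and for
  \<open>a = x\<close>.\<close>

lemma g_mult_positives:
  assumes x: "x \<in> positives" and y: "y \<in> positives"
  shows "g (x * y) = g x * g y"
proof -
  have xy: "x * y \<in> positives" using x y by (simp add: positives_mult_iff)
  define b where "b = pos_sqrt (x * y)"
  have b: "b \<in> positives" "b\<^sup>2 = x * y" unfolding b_def using pos_sqrt[OF xy] by auto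
  have b0: "b \<noteq> 0" "g b \<noteq> 0"
    using positive_not_zero[OF b(1)] positive_not_zero[OF g_positive[OF b(1)]] by simp_all
  have "g (x * y) = (g b)\<^sup>2" using g_square[OF b0] b by simp
  also have "\<dots> = g x * g (b\<^sup>2 / x)" by (rule g_square_div[OF x b0])
  also have "b\<^sup>2 / x = y" using b positive_not_zero[OF x] by simp
  finally show ?thesis .
qed

text \<open>Here \<open>c\<close> may also be zero or negative: the block has rows
  \<open>(1, b)\<close> and \<open>(b, c)\<close> with \<open>b\<close> the positive root of
  \<open>y\<close>.\<close>

lemma g_below:
  assumes y: "y \<in> positives" and c: "c - y \<in> positives"
  shows "g c - g y \<in> positives"
proof -
  define b where "b = pos_sqrt y"
  have b: "b \<in> positives" "b\<^sup>2 = y" unfolding b_def using pos_sqrt[OF y] by auto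
  then have "g 1 * g c - (g b)\<^sup>2 \<in> positives" using c by (intro g_minor) auto
  moreover have "(g b)\<^sup>2 = g y"
    using g_square[of b] b positive_not_zero[OF b(1)] positive_not_zero[OF g_positive[OF b(1)]] by simp
  ultimately show ?thesis by (simp add: g_one)
qed

lemma g_image_below:
  "g ` {y \<in> positives. c - y \<in> positives} \<subseteq> {y \<in> positives. g c - y \<in> positives}"
  using g_below g_positive by auto

lemma card_g_image_below:
  "card (g ` {y \<in> positives. c - y \<in> positives}) = card {y \<in> positives. c - y \<in> positives}"
  by (intro card_image inj_on_subset[OF g_bij(1)]) auto

text \<open>\<open>g\<close> embeds the positive elements below \<open>c\<close> into those below
  \<open>g c\<close>. For negative \<open>c\<close> there is one more of them than for a positive
  element, and below 0 there are none, which leaves only negative values for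
  \<open>g c\<close>.\<close>

lemma g_not_positive:
  assumes "c \<noteq> 0" "c \<notin> positives"
  shows "g c \<noteq> 0 \<and> g c \<notin> positives"
proof -
  let ?B = "\<lambda>c::'a. card {y \<in> positives. c - y \<in> positives}"
  have "?B c \<le> ?B (g c)"
    using card_mono[OF _ g_image_below[of c]] card_g_image_below[of c] by simp
  \<comment> \<open>Scaling by the positive element \<open>- c\<close> reduces negative
    \<open>c\<close> to -1.\<close>
  moreover have "?B c = ?B 1 + 1"
    using card_positives_below_mult[of "- c" "-1"] card_positives_below_minus_one
      uminus_positive_iff[OF assms(1)] assms(2) by simp
  ultimately have gt: "?B (g c) > ?B 1" by simp
  have B0: "?B 0 = 0"
  proof -
    have "- y \<notin> positives" if "y \<in> positives" for y :: 'a
      using uminus_positive_iff[OF positive_not_zero[OF that]] that by simp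
    then have "{y \<in> positives. (0::'a) - y \<in> positives} = {}" by auto
    then show ?thesis by simp
  qed
  have "?B (g c) = ?B 1" if "g c \<in> positives"
    using card_positives_below_mult[OF that, of 1] by simp
  then have "g c \<notin> positives" using gt by auto
  moreover have "?B (g c) \<noteq> ?B 0" unfolding B0 using gt by linarith
  then have "g c \<noteq> 0" by metis
  ultimately show ?thesis by blast
qed

lemma g_minus_positive:
  assumes "x \<in> positives" shows "g (- x) = - g x"
proof -
  have x: "x \<noteq> 0" "- x \<noteq> 0" using positive_not_zero[OF assms] by auto
  have gx: "g (- x) \<noteq> 0" "g (- x) \<notin> positives"
    using g_not_positive[OF x(2)] uminus_positive_iff[OF x(1)] assms by auto
  have gp: "g x \<in> positives" using g_positive[OF assms] .
  have "(g (- x))\<^sup>2 = (g x)\<^sup>2"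
    using g_square[OF x(2) gx(1)] g_square[OF x(1) positive_not_zero[OF gp]] by simp
  then have "g (- x) = g x \<or> g (- x) = - g x" by (simp add: power2_eq_iff)
  then show ?thesis using gx gp by auto
qed

lemma field_cases [case_names zero positive negative]:
  fixes x :: 'a
  obtains "x = 0" | "x \<in> positives" | y where "x = - y" "y \<in> positives"
proof -
  have "x = - (- x)" by simp
  then show ?thesis using that uminus_positive_iff[of x] by metis
qed

lemma g_minus: "g (- x) = - g x"
  by (cases x rule: field_cases) (auto simp: g_zero g_minus_positive)

lemma g_mult: "g (x * y) = g x * g y"
  by (cases x rule: field_cases; cases y rule: field_cases)
     (auto simp: g_zero g_minus g_mult_positives)

lemma g_nonzero: "x \<noteq> 0 \<Longrightarrow> g x \<noteq> 0"
  using g_not_positive[of x] positive_not_zero[OF g_positive, of x] by blast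

lemma g_inj: "inj g"
proof (rule injI)
  fix x y assume xy: "g x = g y"
  show "x = y"
  proof (cases "y = 0")
    case True
    then show ?thesis using xy g_nonzero[of x] g_zero by auto
  next
    case False
    define z where "z = x / y"
    have x: "x = z * y" using False by (simp add: z_def)
    then have gz: "g z = 1" using xy g_mult[of z y] g_nonzero[OF False] by simp
    have "z \<noteq> 0" using gz g_zero by auto
    then have "z \<in> positives" using g_not_positive[of z] gz by auto
    then have "z = 1" using inj_onD[OF g_bij(1), of z 1] gz g_one by simp
    then show ?thesis using x by simp
  qed
qed

text \<open>Since \<open>g (-1) = -1\<close>, the embedding of the positive elements below -1 is a
  self-map of a finite set, hence onto. As \<open>-1 - y\<close> is the negative of
  \<open>1 + y\<close>, this decides the sign of \<open>1 + y\<close>.\<close>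

lemma one_plus_positive_iff:
  assumes y: "y \<in> positives" shows "1 + g y \<in> positives \<longleftrightarrow> 1 + y \<in> positives"
proof -
  let ?B = "{y \<in> positives. (-1::'a) - y \<in> positives}"
  have gm1: "g (-1) = -1" using g_minus[of 1] g_one by simp
  have B: "g ` ?B = ?B"
    by (rule card_subset_eq[OF _ g_image_below[of "-1", unfolded gm1] card_g_image_below[of "-1"]])
       simp
  have gB: "g y \<in> ?B \<longleftrightarrow> y \<in> ?B"
  proof
    assume "g y \<in> ?B"
    then have "g y \<in> g ` ?B" using B by simp
    then show "y \<in> ?B" unfolding inj_image_mem_iff[OF g_inj] .
  next
    assume "y \<in> ?B"
    then have "g y \<in> g ` ?B" by (rule imageI)
    then show "g y \<in> ?B" unfolding B .
  qed
  have "z \<in> ?B \<longleftrightarrow> 1 + z \<notin> positives" if "z \<in> positives" for z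
  proof -
    have "1 + z \<noteq> 0"
    proof
      assume "1 + z = 0"
      then have "z = - 1" by (simp add: add_eq_0_iff)
      then show False using that uminus_positive_iff[of "1::'a"] by simp
    qed
    then show ?thesis using uminus_positive_iff[of "1 + z"] that by simp
  qed
  from this[OF y] this[OF g_positive[OF y]] gB show ?thesis by argo
qed

text \<open>The quadratic characters of \<open>1 + g x\<close> and \<open>1 + x\<close> agree.
  Euler's criterion writes this as an identity of powers, which allows comparing
  coefficients.\<close>

lemma g_power_half: "(1 + g x) ^ half = (1 + x) ^ half"
proof -
  have eq0: "1 + g x = 0 \<longleftrightarrow> 1 + x = 0"
  proof -
    have "1 + g x = 0 \<longleftrightarrow> g x = g (-1)" using g_minus[of 1] g_one by (simp add: add_eq_0_iff)
    also have "\<dots> \<longleftrightarrow> 1 + x = 0" using inj_eq[OF g_inj] by (simp add: add_eq_0_iff)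
    finally show ?thesis .
  qed
  have "1 + g x \<in> positives \<longleftrightarrow> 1 + x \<in> positives"
  proof (cases x rule: field_cases)
    \<comment> \<open>Now \<open>1 + x\<close> and \<open>1 + g x\<close> are the differences
      \<open>1 - y\<close> and \<open>1 - g y\<close> of positive elements, so order reflection
      applies.\<close>
    case (negative y)
    then show ?thesis using g_order_iff[of 1 y] g_one g_minus by simp
  qed (auto simp: g_zero one_plus_positive_iff)
  then consider "1 + x = 0" "1 + g x = 0" | "1 + x \<in> positives" "1 + g x \<in> positives"
    | "1 + x \<noteq> 0" "1 + g x \<noteq> 0" "1 + x \<notin> positives" "1 + g x \<notin> positives"
    using eq0 by argo
  then show ?thesis
  proof cases
    case 1
    then show ?thesis by simp
  next
    case 2
    then show ?thesis by (simp add: positives_iff)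
  next
    case 3
    then show ?thesis by (simp add: power_half_not_positive)
  qed
qed

end

section \<open>Exponents of the quadratic character identity\<close>

lemma coeff_one_plus_X_power:
  "poly.coeff ([:1, 1:] ^ n :: 'a::comm_semiring_1 poly) i = of_nat (n choose i)"
proof (cases "i \<le> n")
  case True
  then show ?thesis by (simp add: coeff_linear_poly_power)
next
  case False
  have "degree ([:1, 1:] ^ n :: 'a poly) \<le> n"
    using degree_power_le[of "[:1, 1:] :: 'a poly" n] by simp
  then show ?thesis using False by (simp add: coeff_eq_0 binomial_eq_0)
qed

text \<open>Lucas' theorem with the lowest \<open>b\<close> digits treated as one block: from
  \<open>(1 + X) ^ q = 1 + X ^ q\<close> the power splits as
  \<open>(1 + X ^ q) ^ M * (1 + X) ^ m\<close>.\<close>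

lemma binomial_Lucas:
  fixes q :: nat
  assumes q: "q = CHAR('a::finite_field) ^ b" and "m < q" and "j < q"
  shows "(of_nat ((m + q * M) choose (j + a * q)) :: 'a) = of_nat (M choose a) * of_nat (m choose j)"
proof -
  define X :: "'a poly" where "X = [:1, 1:]"
  define i where "i = j + a * q"
  have X: "X = Polynomial.monom 1 1 + 1"
    by (simp add: X_def monom_altdef one_pCons)
  have "X ^ q = Polynomial.monom 1 1 ^ q + 1 ^ q"
    unfolding X by (rule freshmans_dream') (simp_all add: q)
  then have Xq: "X ^ q = Polynomial.monom 1 q + 1" by (simp add: monom_power)
  have "X ^ (m + q * M) = (X ^ q) ^ M * X ^ m"
    unfolding power_add power_mult by (rule mult.commute)
  also have "\<dots> = (Polynomial.monom 1 q + 1) ^ M * X ^ m"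
    by (simp only: Xq)
  also have "(Polynomial.monom 1 q + 1 :: 'a poly) ^ M = (\<Sum>c\<le>M. Polynomial.monom (of_nat (M choose c)) (q * c))"
    by (simp add: binomial_ring monom_power of_nat_monom mult_monom mult.commute)
  finally have "poly.coeff (X ^ (m + q * M)) i
      = (\<Sum>c\<le>M. poly.coeff (Polynomial.monom (of_nat (M choose c)) (q * c) * X ^ m) i)"
    by (simp add: sum_distrib_right coeff_sum)
  \<comment> \<open>The summand for \<open>c\<close> lives in degrees \<open>q * c\<close> to
    \<open>q * c + m\<close> with \<open>m < q\<close>, so only \<open>c = a\<close> reaches degree
    \<open>j + a * q\<close>.\<close>
  also have "\<dots> = (\<Sum>c\<le>M. if c = a then of_nat (M choose a) * of_nat (m choose j) else 0)"
  proof (rule sum.cong[OF refl])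
    fix c
    consider "c = a" | "c < a" | "c > a" by linarith
    then show "poly.coeff (Polynomial.monom (of_nat (M choose c)) (q * c) * X ^ m) i
      = (if c = a then of_nat (M choose a) * of_nat (m choose j) else (0::'a))"
    proof cases
      case 1
      then show ?thesis
        by (simp add: i_def coeff_monom_mult coeff_one_plus_X_power X_def mult.commute[of a q])
    next
      case 2
      then have "q * Suc c \<le> q * a" by (intro mult_le_mono2) simp
      then have "m < i - q * c" "q * c \<le> i"
        using \<open>m < q\<close> by (simp_all add: i_def mult.commute[of a q])
      then show ?thesis using 2
        by (simp add: coeff_monom_mult coeff_one_plus_X_power X_def binomial_eq_0)
    next
      case 3
      then have "q * Suc a \<le> q * c" by (intro mult_le_mono2) simp
      then have "i < q * c"
        using \<open>j < q\<close> by (simp add: i_def mult.commute[of a q])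
      then show ?thesis using 3 by (simp add: coeff_monom_mult)
    qed
  qed
  \<comment> \<open>For \<open>a > M\<close> no summand matches, and \<open>M choose a\<close> is
    zero as well.\<close>
  also have "\<dots> = of_nat (M choose a) * of_nat (m choose j)"
    by (simp add: binomial_eq_0)
  finally show ?thesis by (simp add: X_def coeff_one_plus_X_power i_def)
qed

text \<open>\<open>h choose a\<close> divides \<open>fact h\<close>, which a prime larger than
  \<open>h\<close> does not divide.\<close>

lemma binomial_small_nonzero:
  assumes "a \<le> h" "h < CHAR('a::finite_field)"
  shows "(of_nat (h choose a) :: 'a) \<noteq> 0"
proof
  assume "(of_nat (h choose a) :: 'a) = 0"
  then have "CHAR('a) dvd h choose a" by (simp only: of_nat_eq_0_iff_char_dvd)
  then have "CHAR('a) dvd fact a * fact (h - a) * (h choose a)" by simp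
  then have "CHAR('a) dvd (fact h :: nat)" by (simp only: binomial_fact_lemma[OF assms(1)])
  then show False using assms(2) by (simp add: prime_dvd_fact_iff)
qed

text \<open>Cyclicity of the multiplicative group of a finite field, carried over from the ring
  record \<open>R\<close> that copies the operations of the type.\<close>

lemma finite_field_generator:
  obtains w :: "'a::finite_field" where "w \<noteq> 0" and "inj_on (\<lambda>i. w ^ i) {..<CARD('a) - 1}"
    and "\<And>x. x \<noteq> 0 \<Longrightarrow> \<exists>i. x = w ^ i"
proof -
  define R :: "'a ring" where "R = \<lparr> carrier = UNIV, mult = (*), one = 1, zero = 0, add = (+) \<rparr>"
  have R: "carrier R = UNIV" "\<And>x y. x \<otimes>\<^bsub>R\<^esub> y = x * y" "\<one>\<^bsub>R\<^esub> = 1" "\<zero>\<^bsub>R\<^esub> = 0"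
    "\<And>x y. x \<oplus>\<^bsub>R\<^esub> y = x + y"
    by (simp_all add: R_def)
  have inverses: "\<exists>y. x + y = 0" for x :: 'a
    by (intro exI[of _ "- x"]) simp
  have "cring R"
    by unfold_locales (simp_all add: R algebra_simps Units_def inverses)
  then interpret field R
  proof (rule cring.cring_fieldI)
    have "\<exists>y. y * x = 1 \<and> x * y = 1" if "x \<noteq> 0" for x :: 'a
      using that by (intro exI[of _ "inverse x"]) simp
    then show "Units R = carrier R - {\<zero>\<^bsub>R\<^esub>}"
      by (auto simp: Units_def R)
  qed
  have pow: "x [^]\<^bsub>R\<^esub> (i::nat) = x ^ i" for x i
    by (induction i) (simp_all add: R)
  have "finite (carrier R)" by (simp add: R)
  from finite_field_mult_group_has_gen[OF this] obtain w
    where "w \<in> carrier (mult_of R)" "carrier (mult_of R) = {w [^]\<^bsub>R\<^esub> i |i::nat. i \<in> UNIV}"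
    by (elim bexE)
  then have w: "w \<noteq> 0" "UNIV - {0} = {w ^ i |i::nat. i \<in> UNIV}"
    by (simp_all add: R pow)
  define N where "N = CARD('a) - 1"
  have "card {0, 1 :: 'a} \<le> CARD('a)" by (intro card_mono) simp_all
  then have card: "CARD('a) = Suc N" "N > 0" by (simp_all add: N_def)
  have wN: "w ^ N = 1"
    using w(1) finite_field_power_card_eq_same[of w] by (simp add: card)
  have wmod: "w ^ i = w ^ (i mod N)" for i
  proof -
    have "w ^ i = w ^ (N * (i div N) + i mod N)" by simp
    also have "\<dots> = w ^ (i mod N)" unfolding power_add power_mult wN by simp
    finally show ?thesis .
  qed
  \<comment> \<open>The \<open>N\<close> exponents below \<open>N\<close> already reach all
    \<open>N\<close> nonzero elements, so these powers are distinct.\<close>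
  have "UNIV - {0} = (\<lambda>i. w ^ i) ` {..<N}"
  proof (intro equalityI subsetI)
    fix x assume "x \<in> UNIV - {0::'a}"
    then obtain i where "x = w ^ i" unfolding w(2) by auto
    then have "x = w ^ (i mod N)" using wmod by simp
    then show "x \<in> (\<lambda>i. w ^ i) ` {..<N}"
      using card(2) by (intro image_eqI[of _ _ "i mod N"]) simp_all
  qed (use w(1) in auto)
  moreover have "card (UNIV - {0::'a}) = card {..<N}"
    using card by (simp add: card_Diff_singleton)
  ultimately have "inj_on (\<lambda>i. w ^ i) {..<N}" by (intro eq_card_imp_inj_on) simp_all
  moreover have "\<exists>i. x = w ^ i" if "x \<noteq> 0" for x
  proof -
    have "x \<in> {w ^ i |i::nat. i \<in> UNIV}" unfolding w(2)[symmetric] using that by simp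
    then show ?thesis by auto
  qed
  ultimately show ?thesis using that[of w] w(1) by (simp add: N_def)
qed

lemma sum_powers_add:
  "(\<Sum>l<b + n. p ^ l) = (\<Sum>l<b. p ^ l) + p ^ b * (\<Sum>l<n. p ^ l :: nat)"
  by (induction n) (simp_all add: power_add distrib_left)

section \<open>Power maps and their exponents modulo q - 1\<close>

context definite_field
begin

lemma power_mod_card:
  assumes "(x::'a) \<noteq> 0" shows "x ^ (i mod (2 * half)) = x ^ i"
proof -
  have "x ^ i = x ^ (2 * half * (i div (2 * half)) + i mod (2 * half))" by simp
  also have "\<dots> = x ^ (i mod (2 * half))"
    unfolding power_add power_mult[of x "2 * half"] power_card_minus_1[OF assms] by simp
  finally show ?thesis by simp
qed

lemma multiplicative_imp_power:
  fixes g :: "'a \<Rightarrow> 'a"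
  assumes "g 0 = 0" "g 1 = 1" "\<And>x y. g (x * y) = g x * g y" "inj g"
  obtains e where "g = (\<lambda>x. x ^ e)"
proof -
  obtain w :: 'a where w: "w \<noteq> 0" "\<And>x::'a. x \<noteq> 0 \<Longrightarrow> \<exists>i. x = w ^ i"
    using finite_field_generator by blast
  have gpow: "g (x ^ i) = g x ^ i" for x i
    using assms(2,3) by (induction i) simp_all
  have "g w \<noteq> 0" using w(1) assms(1) injD[OF assms(4), of w 0] by auto
  then obtain e0 where e0: "g w = w ^ e0" using w by blast
  \<comment> \<open>Adding q - 1 changes no power of \<open>w\<close> but makes the exponent
    positive, so that 0 is sent to 0.\<close>
  define e where "e = e0 + 2 * half"
  have e: "g w = w ^ e" using e0 w(1) by (simp add: e_def power_add power_card_minus_1)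
  have "g x = x ^ e" for x
  proof (cases "x = 0")
    case True
    then show ?thesis using assms(1) half_pos by (simp add: e_def power_0_left)
  next
    case False
    then obtain i where "x = w ^ i" using w by blast
    then show ?thesis using gpow[of w i] e by (simp add: power_mult[symmetric] mult.commute)
  qed
  then show ?thesis using that by blast
qed

text \<open>Evaluated at a generator, injectivity of the power map says that multiplication by
  \<open>e\<close> is injective modulo q - 1.\<close>

lemma exponent_inj:
  assumes "inj (\<lambda>x::'a. x ^ e)" "i < 2 * half" "j < 2 * half"
    and "(e * i) mod (2 * half) = (e * j) mod (2 * half)"
  shows "i = j"
proof -
  obtain w :: 'a where w0: "w \<noteq> 0" and w: "inj_on (\<lambda>i. w ^ i) {..<CARD('a) - 1}"
    using finite_field_generator by blast
  have "(w ^ i) ^ e = w ^ ((e * i) mod (2 * half))"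
    unfolding power_mod_card[OF w0] by (simp add: power_mult[symmetric] mult.commute)
  also have "\<dots> = (w ^ j) ^ e"
    unfolding assms(4) power_mod_card[OF w0] by (simp add: power_mult[symmetric] mult.commute)
  finally have "w ^ i = w ^ j" using injD[OF assms(1)] by blast
  then show ?thesis using assms(2,3) card_eq_half by (intro inj_onD[OF w]) simp_all
qed

text \<open>Both sides of \<open>(1 + x ^ e) ^ half = (1 + x) ^ half\<close> reduce to polynomials of degree less
  than \<open>q - 1\<close> that agree on all nonzero elements, so their coefficients agree.\<close>

lemma exponent_bound:
  assumes inj: "inj (\<lambda>x::'a. x ^ e)"
    and e: "\<And>x::'a. (1 + x ^ e) ^ half = (1 + x) ^ half"
    and j: "(of_nat (half choose j) :: 'a) \<noteq> 0"
  shows "(e * j) mod (2 * half) \<le> half"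
proof (rule ccontr)
  define N where "N = 2 * half"
  have N: "half < N" "0 < N" using half_pos by (simp_all add: N_def)
  define P :: "'a poly"
    where "P = (\<Sum>i\<le>half. Polynomial.monom (of_nat (half choose i)) ((e * i) mod N))"
  assume "\<not> (e * j) mod (2 * half) \<le> half"
  then have r: "(e * j) mod N > half" by (simp add: N_def)
  have jh: "j \<le> half" by (rule ccontr) (use j in \<open>simp add: binomial_eq_0\<close>)
  have "P = [:1, 1:] ^ half"
  proof (rule poly_eqI_degree[of "UNIV - {0}"])
    fix x :: 'a assume "x \<in> UNIV - {0}"
    then have x: "x \<noteq> 0" by simp
    have "poly P x = (\<Sum>i\<le>half. of_nat (half choose i) * (x ^ e) ^ i)"
      using power_mod_card[OF x] by (simp add: P_def poly_sum poly_monom N_def power_mult)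
    also have "\<dots> = (x ^ e + 1) ^ half" by (simp add: binomial_ring)
    also have "\<dots> = (1 + x) ^ half" using e[of x] by (simp add: add.commute)
    finally show "poly P x = poly ([:1, 1:] ^ half) x" by (simp add: add.commute)
  next
    have "degree P \<le> N - 1"
      unfolding P_def
    proof (rule degree_sum_le)
      fix i
      have "(e * i) mod N \<le> N - 1" using mod_less_divisor[OF N(2), of "e * i"] by linarith
      then show "degree (Polynomial.monom (of_nat (half choose i)) ((e * i) mod N) :: 'a poly) \<le> N - 1"
        using degree_monom_le order_trans by blast
    qed simp
    moreover have "card (UNIV - {0::'a}) = N"
      using card_eq_half by (simp add: card_Diff_singleton N_def)
    ultimately show "degree P < card (UNIV - {0::'a})" using N by simp
    have "degree ([:1, 1:] ^ half :: 'a poly) \<le> half"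
      using degree_power_le[of "[:1, 1:] :: 'a poly" half] by simp
    then show "degree ([:1, 1:] ^ half :: 'a poly) < card (UNIV - {0::'a})"
      using N \<open>card (UNIV - {0::'a}) = N\<close> by simp
  qed
  then have "poly.coeff P ((e * j) mod N) = 0"
    using r by (simp add: coeff_one_plus_X_power binomial_eq_0)
  \<comment> \<open>Distinct \<open>i\<close> below \<open>N\<close> give distinct residues of
    \<open>e * i\<close>, so no other term can cancel the coefficient belonging to
    \<open>j\<close>.\<close>
  moreover have "poly.coeff P ((e * j) mod N)
      = (\<Sum>i\<le>half. if i = j then of_nat (half choose i) else 0)"
    unfolding P_def coeff_sum
  proof (rule sum.cong[OF refl])
    fix i assume "i \<in> {..half}"
    then have "(e * i) mod N = (e * j) mod N \<longleftrightarrow> i = j"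
      using exponent_inj[OF inj, of i j] jh N by (auto simp: N_def)
    then show "poly.coeff (Polynomial.monom (of_nat (half choose i)) ((e * i) mod N)) ((e * j) mod N)
      = (if i = j then of_nat (half choose i) else (0::'a))" by simp
  qed
  ultimately show False using j jh by simp
qed

lemma odd_CHAR: "CHAR('a) = 2 * ((CHAR('a) - 1) div 2) + 1"
proof -
  have "CHAR('a) dvd CARD('a)" by (rule CHAR_dvd_CARD)
  moreover have "odd CARD('a)" using card_eq_half by simp
  ultimately have "odd CHAR('a)" using dvd_trans by blast
  then show ?thesis by (auto elim!: oddE)
qed

text \<open>The lower index has base-p digit \<open>a\<close> in place \<open>b\<close>, zeros above
  it, and below it either all zeros or all \<open>(p - 1) div 2\<close>. Every digit is at most the
  matching digit of \<open>half\<close>.\<close>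

lemma half_choose_nonzero:
  assumes card: "CARD('a) = CHAR('a) ^ k" and b: "b < k" and a: "a \<le> (CHAR('a) - 1) div 2"
    and j: "j = 0 \<or> j = (CHAR('a) - 1) div 2 * (\<Sum>l<b. CHAR('a) ^ l)"
  shows "(of_nat (half choose (j + a * CHAR('a) ^ b)) :: 'a) \<noteq> 0"
proof -
  define p where "p = CHAR('a)"
  define h where "h = (p - 1) div 2"
  define G where "G n = (\<Sum>l<n. p ^ l)" for n
  have p: "p = 2 * h + 1" unfolding h_def p_def by (rule odd_CHAR)
  \<comment> \<open>The number \<open>h * G n\<close>, with \<open>n\<close> digits all equal to
    \<open>h\<close>, is half of \<open>p ^ n - 1\<close>.\<close>
  have G: "p ^ n = 2 * (h * G n) + 1" for n
    by (induction n) (simp_all add: G_def p algebra_simps)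
  have half: "half = h * G k" using G[of k] card card_eq_half by (simp add: p_def)
  obtain c where c: "k = b + Suc c" using b less_iff_Suc_add by auto
  define M where "M = h + p * (h * G c)"
  have "G (Suc c) = 1 + p * G c"
    using sum_powers_add[of p 1 c] by (simp add: G_def)
  moreover have "G k = G b + p ^ b * G (Suc c)"
    unfolding c G_def by (rule sum_powers_add)
  ultimately have half_eq: "half = h * G b + p ^ b * M"
    by (simp add: half M_def algebra_simps)
  have less: "h * G b < p ^ b" "h < p" using G[of b] p by simp_all
  have jc: "j = 0 \<or> j = h * G b" using j by (simp add: h_def G_def p_def)
  then have "j < p ^ b" using less by auto
  then have "(of_nat (half choose (j + a * p ^ b)) :: 'a)
      = of_nat (M choose a) * of_nat ((h * G b) choose j)"
    unfolding half_eq using less by (intro binomial_Lucas[where b = b]) (simp_all add: p_def)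
  also have "(of_nat ((h * G b) choose j) :: 'a) = 1" using jc by auto
  \<comment> \<open>A second application, with a one-digit block, keeps only the lowest digit
    \<open>h\<close> of \<open>M\<close>.\<close>
  also have "(of_nat (M choose a) :: 'a) = of_nat (h choose a)"
    using binomial_Lucas[of p 1 h a "h * G c" 0, where 'a = 'a] less a
    by (simp add: M_def p_def h_def)
  finally show ?thesis
    using binomial_small_nonzero[of a h, where 'a = 'a] a less by (simp add: p_def h_def)
qed

text \<open>The \<open>t l\<close> are the base-\<open>p\<close> digits of \<open>r 0\<close>, most
  significant first, obtained by long division of \<open>r 0\<close> by \<open>N\<close>. Summing
  over a period turns the bound on the residues into a bound on the digit sum.\<close>

lemma exponent_is_CHAR_power:
  assumes card: "CARD('a) = CHAR('a) ^ k"
    and inj: "inj (\<lambda>x::'a. x ^ e)"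
    and e: "\<And>x::'a. (1 + x ^ e) ^ half = (1 + x) ^ half"
  shows "\<exists>i<k. e mod (2 * half) = CHAR('a) ^ i"
proof -
  define p where "p = CHAR('a)"
  define h where "h = (p - 1) div 2"
  define N where "N = 2 * half"
  define r where "r l = (e * p ^ l) mod N" for l
  define t where "t l = (p * r l) div N" for l
  have p: "p = 2 * h + 1" unfolding h_def p_def by (rule odd_CHAR)
  have N: "0 < N" "p ^ k = N + 1"
    using half_pos card card_eq_half by (simp_all add: N_def p_def)
  have "prime p" by (simp add: p_def)
  then have "p > 1" by (rule prime_gt_1_nat)
  have h: "0 < h" using p \<open>p > 1\<close> by linarith
  have k: "0 < k" using N by (cases k) auto
  have r_le: "r l \<le> half" if "l < k" for l
  proof -
    have "(of_nat (half choose (0 + 1 * CHAR('a) ^ l)) :: 'a) \<noteq> 0"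
      using half_choose_nonzero[OF card that, of 1 0] h by (simp add: h_def p_def)
    then show ?thesis using exponent_bound[OF inj e] by (simp add: r_def p_def N_def)
  qed
  text \<open>The exponent \<open>h * (\<Sum>l<b. p ^ l) + a * p ^ b\<close> is sent to this sum modulo \<open>N\<close>; raising \<open>a\<close>
    by one adds at most \<open>half\<close>, so the sum cannot wrap around before it is reduced.\<close>
  have main: "h * (\<Sum>l<b. r l) + a * r b \<le> half"
    if "b < k" "a \<le> h" "h * (\<Sum>l<b. r l) \<le> half" for a b
    using that(2)
  proof (induction a)
    case 0
    then show ?case using that(3) by simp
  next
    case (Suc a)
    define S where "S = h * (\<Sum>l<b. r l) + Suc a * r b"
    define j where "j = h * (\<Sum>l<b. p ^ l) + Suc a * p ^ b"
    have nz: "(of_nat (half choose j) :: 'a) \<noteq> 0"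
      using half_choose_nonzero[OF card that(1), of "Suc a" "h * (\<Sum>l<b. p ^ l)"] Suc.prems
      by (simp add: j_def h_def p_def)
    have "S = h * (\<Sum>l<b. r l) + a * r b + r b" by (simp add: S_def)
    also have "\<dots> \<le> half + half" using Suc r_le[OF that(1)] by (intro add_mono) simp_all
    finally have "S \<le> N" by (simp add: N_def)
    have "[h * (\<Sum>l<b. r l) + Suc a * r b = h * (\<Sum>l<b. e * p ^ l) + Suc a * (e * p ^ b)] (mod N)"
      unfolding r_def by (intro cong_add cong_mult cong_sum cong_refl) (simp_all add: cong_def)
    moreover have "h * (\<Sum>l<b. e * p ^ l) + Suc a * (e * p ^ b) = e * j"
      by (simp add: j_def sum_distrib_left algebra_simps)
    ultimately have cong: "S mod N = (e * j) mod N" by (simp add: S_def cong_def)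
    have le: "S mod N \<le> half"
      unfolding cong using exponent_bound[OF inj e nz] by (simp add: N_def)
    \<comment> \<open>The residue 0 would meet the bound too, so \<open>S = N\<close> is excluded
      separately: \<open>j\<close> lies strictly between 0 and \<open>N\<close>, and
      \<open>e * j\<close> cannot be 0 modulo \<open>N\<close>.\<close>
    have "S \<noteq> N"
    proof
      assume "S = N"
      then have "(e * j) mod (2 * half) = (e * 0) mod (2 * half)" using cong by (simp add: N_def)
      moreover have "j < 2 * half"
      proof -
        have "j \<le> half" by (rule ccontr) (use nz in \<open>simp add: binomial_eq_0\<close>)
        then show ?thesis using half_pos by simp
      qed
      ultimately have "j = 0" using half_pos by (intro exponent_inj[OF inj, of j 0]) simp_all
      then show False using \<open>p > 1\<close> by (simp add: j_def)
    qed
    then have "S mod N = S" using \<open>S \<le> N\<close> by simp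
    then show ?case using le by (simp add: S_def)
  qed
  \<comment> \<open>Filling digit \<open>b\<close> completely, with \<open>a = h\<close>, moves the
    bound from \<open>b\<close> to \<open>b + 1\<close>.\<close>
  have step: "h * (\<Sum>l<b. r l) \<le> half" if "b \<le> k" for b
    using that
  proof (induction b)
    case (Suc b)
    then show ?case using main[of b h] by (simp add: algebra_simps)
  qed simp
  from step[of k] have sum_le: "(p - 1) * (\<Sum>l<k. r l) \<le> N" by (simp add: p N_def)
  have rec: "p * r l = N * t l + r (Suc l)" for l
  proof -
    have "r (Suc l) = (p * r l) mod N"
      unfolding r_def by (simp add: mod_simps mult.left_commute)
    then show ?thesis by (simp add: t_def)
  qed
  \<comment> \<open>Since \<open>p ^ k\<close> is 1 modulo \<open>N\<close>, the residues have
    period \<open>k\<close>.\<close>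
  have "[p ^ k = 1] (mod N)" unfolding N(2) cong_def by (rule mod_add_self1)
  then have "[e * p ^ k = e * 1] (mod N)" by (intro cong_mult cong_refl)
  then have rk: "r k = r 0" by (simp add: r_def cong_def)
  have r0: "r 0 \<noteq> 0"
  proof
    assume "r 0 = 0"
    then have "(e * 1) mod (2 * half) = (e * 0) mod (2 * half)" by (simp add: r_def N_def)
    then have "(1::nat) = 0" using half_pos by (intro exponent_inj[OF inj, of 1 0]) simp_all
    then show False by simp
  qed
  have "p * (\<Sum>l<k. r l) = N * (\<Sum>l<k. t l) + (\<Sum>l<k. r (Suc l))"
    by (simp add: sum_distrib_left rec sum.distrib)
  also have "(\<Sum>l<k. r (Suc l)) = (\<Sum>l<k. r l)"
    using sum.lessThan_Suc_shift[of r k] rk by simp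
  finally have eq: "(p - 1) * (\<Sum>l<k. r l) = N * (\<Sum>l<k. t l)"
    by (simp add: diff_mult_distrib)
  have "r 0 \<le> (\<Sum>l<k. r l)" using k by (intro member_le_sum) simp_all
  then have "0 < (p - 1) * (\<Sum>l<k. r l)" using r0 \<open>p > 1\<close> by simp
  then have "0 < (\<Sum>l<k. t l)" unfolding eq by simp
  moreover have "(\<Sum>l<k. t l) \<le> 1" using sum_le N unfolding eq by simp
  ultimately have "(\<Sum>l<k. t l) = 1" by linarith
  then obtain l0 where l0: "l0 < k" "t l0 = 1" "\<And>l. l < k \<Longrightarrow> l \<noteq> l0 \<Longrightarrow> t l = 0"
    unfolding sum_eq_1_iff[OF finite_lessThan] by (metis lessThan_iff)
  \<comment> \<open>Unrolled long division. For \<open>n = k\<close>, \<open>p ^ k = N + 1\<close>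
    and periodicity cancel one \<open>r 0\<close> and leave its base-\<open>p\<close>
    expansion.\<close>
  have "p ^ n * r 0 = r n + N * (\<Sum>l<n. t l * p ^ (n - 1 - l))" for n
  proof (induction n)
    case (Suc n)
    have "(\<Sum>l<Suc n. t l * p ^ (Suc n - 1 - l)) = t n + (\<Sum>l<n. p * (t l * p ^ (n - 1 - l)))"
    proof -
      have "(\<Sum>l<n. t l * p ^ (n - l)) = (\<Sum>l<n. p * (t l * p ^ (n - 1 - l)))"
      proof (rule sum.cong[OF refl])
        fix l assume "l \<in> {..<n}"
        then have "n - l = Suc (n - 1 - l)" by simp
        then show "t l * p ^ (n - l) = p * (t l * p ^ (n - 1 - l))" by simp
      qed
      then show ?thesis by simp
    qed
    moreover have "p ^ Suc n * r 0 = p * r n + N * (\<Sum>l<n. p * (t l * p ^ (n - 1 - l)))"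
      using Suc by (simp add: distrib_left sum_distrib_left algebra_simps)
    ultimately show ?case using rec[of n] by (simp add: distrib_left)
  qed simp
  from this[of k] have "N * r 0 = N * (\<Sum>l<k. t l * p ^ (k - 1 - l))"
    by (simp add: N(2) rk)
  then have "r 0 = (\<Sum>l<k. t l * p ^ (k - 1 - l))" using N by simp
  also have "\<dots> = (\<Sum>l<k. if l = l0 then p ^ (k - 1 - l) else 0)"
    using l0 by (intro sum.cong) auto
  also have "\<dots> = p ^ (k - 1 - l0)" using l0 by simp
  finally have "e mod (2 * half) = p ^ (k - 1 - l0)" by (simp add: r_def N_def)
  then show ?thesis using k by (intro exI[of _ "k - 1 - l0"]) (simp add: p_def)
qed

end

section \<open>Preservers of positive minors as Frobenius powers\<close>

lemma (in normalized_preserver) g_is_frobenius_power: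
  assumes "CARD('a) = CHAR('a) ^ k"
  shows "\<exists>i<k. g = (\<lambda>x. x ^ CHAR('a) ^ i)"
proof -
  obtain e where e: "g = (\<lambda>x. x ^ e)"
    using multiplicative_imp_power[OF g_zero g_one g_mult g_inj] .
  have "inj (\<lambda>x::'a. x ^ e)" using g_inj unfolding e .
  moreover have "(1 + x ^ e) ^ half = (1 + x) ^ half" for x :: 'a
    using g_power_half[of x] unfolding e .
  ultimately obtain i where i: "i < k" "e mod (2 * half) = CHAR('a) ^ i"
    using exponent_is_CHAR_power[OF assms] by metis
  have "g x = x ^ CHAR('a) ^ i" for x
  proof (cases "x = 0")
    case True
    then show ?thesis by (simp add: g_zero power_0_left)
  next
    case False
    then show ?thesis using power_mod_card[OF False, of e] by (simp add: e i(2))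
  qed
  then show ?thesis using i(1) by auto
qed

text \<open>Dividing \<open>f\<close> by \<open>f 1\<close> divides the determinants by the positive
  element \<open>(f 1)\<^sup>2\<close>, so normalization keeps both conditions.\<close>

lemma (in definite_field) minor_preserver_is_frobenius_power:
  fixes f :: "'a \<Rightarrow> 'a"
  assumes card: "CARD('a) = CHAR('a) ^ k"
    and pos: "\<And>a. a \<in> positives \<Longrightarrow> f a \<in> positives"
    and minor: "\<And>a b c. a \<in> positives \<Longrightarrow> a * c - b\<^sup>2 \<in> positives \<Longrightarrow>
      f a * f c - (f b)\<^sup>2 \<in> positives"
  shows "\<exists>i<k. f = (\<lambda>x. f 1 * x ^ CHAR('a) ^ i)"
proof -
  have f1: "f 1 \<in> positives" "f 1 \<noteq> 0" using pos[of 1] positive_not_zero[of "f 1"] by simp_all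
  define g where "g x = f x / f 1" for x
  have g: "f x = f 1 * g x" for x using f1 by (simp add: g_def)
  interpret normalized_preserver ty g
  proof
    show "g 1 = 1" using f1 by (simp add: g_def)
    show "g a \<in> positives" if "a \<in> positives" for a
      using pos[OF that] f1(1) by (simp add: g_def positives_divide_iff)
    show "g a * g c - (g b)\<^sup>2 \<in> positives"
      if "a \<in> positives" "a * c - b\<^sup>2 \<in> positives" for a b c
    proof -
      have "f a * f c - (f b)\<^sup>2 = (f 1)\<^sup>2 * (g a * g c - (g b)\<^sup>2)"
        unfolding g[of a] g[of b] g[of c] by (simp add: power2_eq_square algebra_simps)
      then have "(f 1)\<^sup>2 * (g a * g c - (g b)\<^sup>2) \<in> positives" using minor[OF that] by simp
      then show ?thesis using square_positive[OF f1(2)] by (simp add: positives_mult_iff)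
    qed
  qed
  obtain i where "i < k" and gi: "g = (\<lambda>x. x ^ CHAR('a) ^ i)"
    using g_is_frobenius_power[OF card] by auto
  have "f x = f 1 * x ^ CHAR('a) ^ i" for x using g[of x] unfolding gi .
  then show ?thesis using \<open>i < k\<close> by blast
qed

section \<open>Leading blocks and the Cholesky map\<close>

text \<open>The leading block by explicit entries, whereas the indices of \<open>submatrix\<close>
  go through \<open>pick\<close>.\<close>

definition lead :: "nat \<Rightarrow> 'a mat \<Rightarrow> 'a mat" where
  "lead k A = mat k k (\<lambda>(i, j). A $$ (i, j))"

lemma lead_carrier [simp]: "lead k A \<in> carrier_mat k k"
  by (simp add: lead_def)

lemma lead_index [simp]: "i < k \<Longrightarrow> j < k \<Longrightarrow> lead k A $$ (i, j) = A $$ (i, j)"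
  by (simp add: lead_def)

lemma lead_dim [simp]: "dim_row (lead k A) = k" "dim_col (lead k A) = k"
  by (simp_all add: lead_def)

lemma lead_lead: "k \<le> n \<Longrightarrow> lead k (lead n A) = lead k A"
  by (intro eq_matI) simp_all

lemma lead_self: "A \<in> carrier_mat n n \<Longrightarrow> lead n A = A"
  by (intro eq_matI) auto

lemma leading_minor_eq:
  assumes "A \<in> carrier_mat n n" "k \<le> n"
  shows "leading_minor A k = det (lead k A)"
proof -
  have pick: "pick {..<k} i = i" if "i < k" for i
  proof -
    have "pick {..<k} (card {a \<in> {..<k}. a < i}) = i"
      using that by (intro pick_card_in_set) simp
    moreover have "{a \<in> {..<k}. a < i} = {..<i}" using that by auto
    ultimately show ?thesis by simp
  qed
  have "{i. i < n \<and> i \<in> {..<k}} = {..<k}" using assms(2) by auto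
  then have "submatrix A {..<k} {..<k} = lead k A"
    unfolding submatrix_def using assms by (intro eq_matI) (simp_all add: pick)
  then show ?thesis by (simp add: leading_minor_def)
qed

lemma mult_mat_index:
  assumes "A \<in> carrier_mat n m" "B \<in> carrier_mat m l" "i < n" "j < l"
  shows "(A * B) $$ (i, j) = (\<Sum>a<m. A $$ (i, a) * B $$ (a, j))"
  using assms by (simp add: scalar_prod_def atLeast0LessThan)

lemma cholesky_carrier [simp]:
  "B \<in> carrier_mat n n \<Longrightarrow> L \<in> carrier_mat n n \<Longrightarrow> cholesky B L \<in> carrier_mat n n"
  by (simp add: cholesky_def)

lemma cholesky_index:
  assumes "B \<in> carrier_mat n n" "L \<in> carrier_mat n n" "i < n" "j < n"
  shows "cholesky B L $$ (i, j) = (\<Sum>b<n. (\<Sum>a<n. L $$ (i, a) * B $$ (a, b)) * L $$ (j, b))"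
proof -
  have "L * B \<in> carrier_mat n n" "transpose_mat L \<in> carrier_mat n n" using assms by simp_all
  then have "cholesky B L $$ (i, j) = (\<Sum>b<n. (L * B) $$ (i, b) * transpose_mat L $$ (b, j))"
    unfolding cholesky_def using assms by (intro mult_mat_index)
  also have "\<dots> = (\<Sum>b<n. (\<Sum>a<n. L $$ (i, a) * B $$ (a, b)) * L $$ (j, b))"
    using assms by (intro sum.cong) (simp_all add: mult_mat_index[of L n n B n] del: index_mult_mat)
  finally show ?thesis .
qed

text \<open>The first \<open>k\<close> rows of a lower triangular \<open>L\<close> vanish beyond the
  first \<open>k\<close> columns, so nothing outside the leading blocks enters.\<close>

lemma lead_cholesky:
  assumes B: "B \<in> carrier_mat n n" and L: "L \<in> carrier_mat n n" and k: "k \<le> n"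
    and lower: "\<And>i j. i < n \<Longrightarrow> j < n \<Longrightarrow> i < j \<Longrightarrow> L $$ (i, j) = 0"
  shows "lead k (cholesky B L) = cholesky (lead k B) (lead k L)"
proof (rule eq_matI)
  fix i j assume "i < dim_row (cholesky (lead k B) (lead k L))" "j < dim_col (cholesky (lead k B) (lead k L))"
  then have ij: "i < k" "j < k" by (simp_all add: cholesky_def)
  have zero: "L $$ (i, a) = 0" if "a \<in> {..<n} - {..<k}" "i < k" for i a
    using that k by (intro lower) auto
  have restrict: "(\<Sum>a<n. L $$ (i, a) * h a) = (\<Sum>a<k. L $$ (i, a) * h a)" if "i < k" for h i
    using k that zero by (intro sum.mono_neutral_right) auto
  have "lead k (cholesky B L) $$ (i, j) = cholesky B L $$ (i, j)" using ij by simp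
  also have "\<dots> = (\<Sum>b<n. L $$ (j, b) * (\<Sum>a<n. L $$ (i, a) * B $$ (a, b)))"
    using ij k by (simp add: cholesky_index[OF B L] mult.commute)
  also have "\<dots> = (\<Sum>b<k. (\<Sum>a<k. L $$ (i, a) * B $$ (a, b)) * L $$ (j, b))"
    unfolding restrict[OF ij(2)] restrict[OF ij(1)] by (simp add: mult.commute)
  also have "\<dots> = cholesky (lead k B) (lead k L) $$ (i, j)"
    using ij by (simp add: cholesky_index[of "lead k B" k "lead k L"])
  finally show "lead k (cholesky B L) $$ (i, j) = cholesky (lead k B) (lead k L) $$ (i, j)" .
qed (simp_all add: cholesky_def)

lemma det_cholesky:
  assumes "B \<in> carrier_mat n n" "L \<in> carrier_mat n n"
  shows "det (cholesky B L) = (det L)\<^sup>2 * det B"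
  unfolding cholesky_def using assms
  by (simp add: det_mult[of L n] det_mult[of B n] det_transpose[of L n] power2_eq_square)

lemma cholesky_mult:
  assumes "B \<in> carrier_mat n n" "L \<in> carrier_mat n n" "M \<in> carrier_mat n n"
  shows "cholesky (cholesky B M) L = cholesky B (L * M)"
proof -
  have T: "transpose_mat L \<in> carrier_mat n n" "transpose_mat M \<in> carrier_mat n n"
    using assms by simp_all
  have "L * (M * B * transpose_mat M) * transpose_mat L
      = L * (M * B) * transpose_mat M * transpose_mat L"
    using assms T by (subst assoc_mult_mat[of L n n "M * B" n "transpose_mat M" n]) simp_all
  also have "L * (M * B) = L * M * B"
    using assms by (subst assoc_mult_mat[of L n n M n B n]) simp_all
  also have "L * M * B * transpose_mat M * transpose_mat L
      = L * M * B * (transpose_mat M * transpose_mat L)"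
    using assms T by (subst assoc_mult_mat[of "L * M * B" n n "transpose_mat M" n "transpose_mat L" n]) simp_all
  also have "transpose_mat M * transpose_mat L = transpose_mat (L * M)"
    using assms by (subst transpose_mult[of L n n M n]) simp_all
  finally show ?thesis unfolding cholesky_def .
qed

lemma cholesky_symmetric:
  assumes "B \<in> carrier_mat n n" "L \<in> carrier_mat n n" "transpose_mat B = B"
  shows "transpose_mat (cholesky B L) = cholesky B L"
proof -
  have T: "transpose_mat L \<in> carrier_mat n n" using assms by simp
  have "transpose_mat (L * B * transpose_mat L) = transpose_mat (transpose_mat L) * transpose_mat (L * B)"
    using assms T by (intro transpose_mult[of _ n n _ n]) simp_all
  also have "transpose_mat (L * B) = B * transpose_mat L"
    using assms by (subst transpose_mult[of L n n B n]) simp_all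
  also have "transpose_mat (transpose_mat L) * (B * transpose_mat L) = L * B * transpose_mat L"
    using assms T by (subst assoc_mult_mat[of L n n B n "transpose_mat L" n]) simp_all
  finally show ?thesis unfolding cholesky_def .
qed

lemma cholesky_diag_index:
  assumes "L \<in> carrier_mat n n" "i < n" "j < n"
  shows "cholesky (mat_diag n d) L $$ (i, j) = (\<Sum>a<n. L $$ (i, a) * d a * L $$ (j, a))"
proof -
  have "(\<Sum>a<n. L $$ (i, a) * mat_diag n d $$ (a, b)) = L $$ (i, b) * d b" if "b < n" for b
  proof -
    have "(\<Sum>a<n. L $$ (i, a) * mat_diag n d $$ (a, b)) = (\<Sum>a<n. if a = b then L $$ (i, a) * d b else 0)"
      using that by (intro sum.cong) (simp_all add: mat_diag_def)
    then show ?thesis using that by simp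
  qed
  then show ?thesis using assms by (simp add: cholesky_index[OF mat_diag_dim assms])
qed

lemma det_lower_triangular_prod:
  assumes "A \<in> carrier_mat n n" "\<And>i j. i < j \<Longrightarrow> j < n \<Longrightarrow> A $$ (i, j) = 0"
  shows "det A = (\<Prod>i<n. A $$ (i, i))"
proof -
  have "det A = prod_list (diag_mat A)" using assms by (intro det_lower_triangular)
  also have "\<dots> = (\<Prod>i<n. A $$ (i, i))"
    using assms(1) by (simp add: diag_mat_def prod.distinct_set_conv_list[symmetric] atLeast0LessThan)
  finally show ?thesis .
qed

lemma det_mat_diag: "det (mat_diag n d) = (\<Prod>i<n. d i)"
  by (subst det_lower_triangular_prod[of _ n]) (simp_all add: mat_diag_def)

lemma lead_mat_diag: "k \<le> n \<Longrightarrow> lead k (mat_diag n d) = mat_diag k d"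
  by (intro eq_matI) (simp_all add: mat_diag_def)

lemma obtain_inverse_mat:
  assumes "A \<in> carrier_mat n n" "det A \<noteq> (0::'a::field)"
  obtains B where "B \<in> carrier_mat n n" "A * B = 1\<^sub>m n"
  using det_non_zero_imp_unit[OF assms, of undefined] that
  by (auto simp: Units_def ring_mat_simps)

text \<open>A matrix of fixed size is encoded by its entries on a finite index set. Finiteness will
  make injective self-maps of \<open>pos_lower n\<close> onto.\<close>

lemma finite_pos_lower: "finite (pos_lower n :: 'a::finite_field mat set)"
proof -
  define F where "F A = restrict (\<lambda>ij. A $$ ij) ({..<n} \<times> {..<n})" for A :: "'a mat"
  have "inj_on F (carrier_mat n n)"
  proof (rule inj_onI)
    fix A B assume AB: "A \<in> carrier_mat n n" "B \<in> carrier_mat n n" "F A = F B"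
    show "A = B"
    proof (rule eq_matI)
      fix i j assume "i < dim_row B" "j < dim_col B"
      then have "(i, j) \<in> {..<n} \<times> {..<n}" using AB by auto
      then show "A $$ (i, j) = B $$ (i, j)"
        using fun_cong[OF AB(3), of "(i, j)"] by (simp add: F_def)
    qed (use AB in auto)
  qed
  moreover have "F ` carrier_mat n n \<subseteq> ({..<n} \<times> {..<n}) \<rightarrow>\<^sub>E (UNIV :: 'a set)"
    unfolding F_def image_subset_iff restrict_PiE_iff by simp
  then have "finite (F ` carrier_mat n n)"
    by (rule finite_subset) (intro finite_PiE; simp)
  ultimately have "finite (carrier_mat n n :: 'a mat set)" by (simp add: finite_image_iff)
  then show ?thesis by (rule rev_finite_subset) (auto simp: pos_lower_def)
qed

section \<open>Bijectivity of the Cholesky maps\<close>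

context definite_field
begin

lemma pos_lowerD:
  assumes "L \<in> pos_lower n"
  shows "L \<in> carrier_mat n n" "\<And>i j. i < n \<Longrightarrow> j < n \<Longrightarrow> i < j \<Longrightarrow> L $$ (i, j) = (0::'a)"
    "\<And>i. i < n \<Longrightarrow> L $$ (i, i) \<in> positives"
  using assms by (auto simp: pos_lower_def)

lemma prod_positive:
  "(\<And>i. i < (n::nat) \<Longrightarrow> d i \<in> positives) \<Longrightarrow> (\<Prod>i<n. d i :: 'a) \<in> positives"
  by (induction n) (simp_all add: positives_mult_iff)

lemma det_pos_lower:
  assumes "L \<in> pos_lower n" shows "det L \<in> (positives :: 'a set)"
proof -
  have "det L = (\<Prod>i<n. L $$ (i, i))"
    using pos_lowerD[OF assms] by (intro det_lower_triangular_prod) simp_all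
  also have "\<dots> \<in> positives" by (intro prod_positive pos_lowerD(3)[OF assms])
  finally show ?thesis .
qed

lemma lead_pos_lower:
  assumes "L \<in> pos_lower n" "k \<le> n" shows "lead k L \<in> (pos_lower k :: 'a mat set)"
  using pos_lowerD[OF assms(1)] assms(2) by (simp add: pos_lower_def)

text \<open>A term \<open>L $$ (i, a) * M $$ (a, j)\<close> survives only for
  \<open>j \<le> a \<le> i\<close>.\<close>

lemma mult_pos_lower:
  assumes L: "L \<in> pos_lower n" and M: "M \<in> pos_lower n"
  shows "L * M \<in> (pos_lower n :: 'a mat set)"
proof -
  note L = pos_lowerD[OF L] and M = pos_lowerD[OF M]
  have zero: "L $$ (i, a) * M $$ (a, j) = 0" if "i < n" "j < n" "a < n" "i < a \<or> a < j" for i j a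
    using L(2)[of i a] M(2)[of a j] that by auto
  have "(L * M) $$ (i, j) = 0" if "i < n" "j < n" "i < j" for i j
  proof -
    have "L $$ (i, a) * M $$ (a, j) = 0" if "a < n" for a
      using \<open>i < j\<close> by (intro zero[OF \<open>i < n\<close> \<open>j < n\<close> that]) linarith
    then show ?thesis
      unfolding mult_mat_index[OF L(1) M(1) that(1,2)] by (intro sum.neutral) blast
  qed
  moreover have "(L * M) $$ (i, i) \<in> positives" if "i < n" for i
  proof -
    have "(L * M) $$ (i, i) = (\<Sum>a<n. if a = i then L $$ (i, i) * M $$ (i, i) else 0)"
      unfolding mult_mat_index[OF L(1) M(1) that that]
    proof (rule sum.cong[OF refl])
      fix a assume "a \<in> {..<n}"
      then show "L $$ (i, a) * M $$ (a, i) = (if a = i then L $$ (i, i) * M $$ (i, i) else 0)"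
        using zero[OF that that, of a] by (cases rule: linorder_cases[of a i]) auto
    qed
    also have "\<dots> = L $$ (i, i) * M $$ (i, i)" using that by simp
    finally show ?thesis using L(3)[OF that] M(3)[OF that] by (simp add: positives_mult_iff)
  qed
  moreover have "L * M \<in> carrier_mat n n" using L(1) M(1) by simp
  ultimately show ?thesis unfolding pos_lower_def by blast
qed

lemma LPM_iff:
  "A \<in> LPM n \<epsilon> \<longleftrightarrow> A \<in> carrier_mat n n \<and> transpose_mat A = A \<and>
    (\<forall>k\<in>{1..n}. quad_char (det (lead k A :: 'a mat)) = \<epsilon> k)"
  by (auto simp: LPM_def leading_minor_eq)

text \<open>Each leading minor is multiplied by the square of the determinant of a leading block of
  \<open>L\<close>, which keeps its quadratic character.\<close>

lemma cholesky_LPM: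
  assumes B: "B \<in> LPM n \<epsilon>" and L: "L \<in> pos_lower n"
  shows "cholesky B L \<in> (LPM n \<epsilon> :: 'a mat set)"
proof -
  have Bc: "B \<in> carrier_mat n n" "transpose_mat B = B" using B by (auto simp: LPM_def)
  have "quad_char (det (lead k (cholesky B L))) = \<epsilon> k" if "k \<in> {1..n}" for k
  proof -
    have k: "k \<le> n" using that by simp
    have "lead k (cholesky B L) = cholesky (lead k B) (lead k L)"
      using pos_lowerD[OF L] by (intro lead_cholesky[OF Bc(1) _ k])
    also have "det \<dots> = (det (lead k L))\<^sup>2 * det (lead k B)"
      by (rule det_cholesky[of _ k]) simp_all
    also have "quad_char \<dots> = quad_char (det (lead k B))"
      using det_pos_lower[OF lead_pos_lower[OF L k]]
      by (intro quad_char_positive_mult square_positive positive_not_zero)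
    also have "\<dots> = \<epsilon> k" using B that by (simp add: LPM_iff)
    finally show ?thesis .
  qed
  then show ?thesis
    using cholesky_symmetric[OF Bc(1) pos_lowerD(1)[OF L] Bc(2)] cholesky_carrier[OF Bc(1) pos_lowerD(1)[OF L]]
    unfolding LPM_iff by blast
qed

definition sign_entry :: "(nat \<Rightarrow> int) \<Rightarrow> nat \<Rightarrow> 'a" where
  "sign_entry \<epsilon> i = (if i = 0 then sign_elt \<epsilon> 1 else sign_elt \<epsilon> i * sign_elt \<epsilon> (i + 1))"

lemma sign_diag_eq: "sign_diag n \<epsilon> = mat_diag n (sign_entry \<epsilon>)"
  unfolding sign_diag_def sign_entry_def ..

lemma sign_entry_nonzero: "sign_entry \<epsilon> i \<noteq> 0"
  by (simp add: sign_entry_def sign_elt_def)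

text \<open>The product telescopes because every sign squares to 1.\<close>

lemma prod_sign_entry: "(\<Prod>i<Suc k. sign_entry \<epsilon> i) = sign_elt \<epsilon> (Suc k)"
proof (induction k)
  case (Suc k)
  have "(\<Prod>i<Suc (Suc k). sign_entry \<epsilon> i)
      = sign_elt \<epsilon> (Suc k) * (sign_elt \<epsilon> (Suc k) * sign_elt \<epsilon> (Suc (Suc k)))"
    unfolding prod.lessThan_Suc[of _ "Suc k"] Suc by (simp add: sign_entry_def)
  also have "\<dots> = sign_elt \<epsilon> (Suc (Suc k))" by (simp add: sign_elt_def)
  finally show ?case .
qed (simp add: sign_entry_def)

lemma quad_char_sign_elt:
  assumes "\<epsilon> k \<in> {1, -1}" shows "quad_char (sign_elt \<epsilon> k :: 'a) = \<epsilon> k"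
  using assms uminus_positive_iff[of "1::'a"] by (auto simp: sign_elt_def quad_char_def)

lemma sign_diag_LPM:
  assumes "\<And>k. k \<in> {1..n} \<Longrightarrow> \<epsilon> k \<in> {1, -1}"
  shows "sign_diag n \<epsilon> \<in> (LPM n \<epsilon> :: 'a mat set)"
proof -
  have "quad_char (det (lead k (mat_diag n (sign_entry \<epsilon>)))) = \<epsilon> k" if k: "k \<in> {1..n}" for k
  proof -
    obtain m where m: "k = Suc m" using k by (cases k) auto
    have "det (lead k (mat_diag n (sign_entry \<epsilon>))) = sign_elt \<epsilon> k"
      using k unfolding m by (subst lead_mat_diag) (simp_all add: det_mat_diag prod_sign_entry del: prod.lessThan_Suc)
    then show ?thesis using quad_char_sign_elt assms[OF k] by simp
  qed
  moreover have "transpose_mat (mat_diag n (sign_entry \<epsilon>)) = mat_diag n (sign_entry \<epsilon>)"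
    by (intro eq_matI) (auto simp: mat_diag_def)
  ultimately show ?thesis by (simp add: LPM_iff sign_diag_eq)
qed

text \<open>Columns are recovered in increasing order. Entry \<open>(j, j)\<close> determines the
  square of \<open>L $$ (j, j)\<close>, positivity selects the root, and the entries
  \<open>(i, j)\<close> then give the rest of the column linearly.\<close>

lemma cholesky_diag_inj:
  assumes d: "\<And>i. i < n \<Longrightarrow> d i \<noteq> (0::'a)"
  shows "inj_on (cholesky (mat_diag n d)) (pos_lower n)"
proof (rule inj_onI)
  fix L M assume LM: "L \<in> pos_lower n" "M \<in> pos_lower n"
    and eq: "cholesky (mat_diag n d) L = cholesky (mat_diag n d) M"
  note L = pos_lowerD[OF LM(1)] and M = pos_lowerD[OF LM(2)]
  have split: "cholesky (mat_diag n d) K $$ (i, j)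
      = (\<Sum>a<j. K $$ (i, a) * d a * K $$ (j, a)) + K $$ (i, j) * d j * K $$ (j, j)"
    if K: "K \<in> pos_lower n" and ij: "i < n" "j < n" for K i j
  proof -
    have "cholesky (mat_diag n d) K $$ (i, j) = (\<Sum>a<n. K $$ (i, a) * d a * K $$ (j, a))"
      by (rule cholesky_diag_index[OF pos_lowerD(1)[OF K] ij])
    also have "\<dots> = (\<Sum>a<Suc j. K $$ (i, a) * d a * K $$ (j, a))"
      using ij pos_lowerD(2)[OF K, of j] by (intro sum.mono_neutral_right) auto
    finally show ?thesis by simp
  qed
  have cols: "\<forall>i<n. L $$ (i, j) = M $$ (i, j)" if "j < n" for j
    using that
  proof (induction j rule: less_induct)
    case (less j)
    have prev: "(\<Sum>a<j. L $$ (i, a) * d a * L $$ (j, a)) = (\<Sum>a<j. M $$ (i, a) * d a * M $$ (j, a))"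
      if "i < n" for i
      using less that by (intro sum.cong) auto
    have ent: "L $$ (i, j) * d j * L $$ (j, j) = M $$ (i, j) * d j * M $$ (j, j)" if "i < n" for i
    proof -
      have "cholesky (mat_diag n d) L $$ (i, j) = cholesky (mat_diag n d) M $$ (i, j)"
        by (simp only: eq)
      then show ?thesis
        unfolding split[OF LM(1) that less.prems] split[OF LM(2) that less.prems] prev[OF that]
        by (rule add_left_imp_eq)
    qed
    have "(L $$ (j, j))\<^sup>2 = (M $$ (j, j))\<^sup>2"
      using ent[OF less.prems] d[OF less.prems] by (simp add: power2_eq_square)
    then have jj: "L $$ (j, j) = M $$ (j, j)"
      by (rule positive_square_inj[OF L(3)[OF less.prems] M(3)[OF less.prems]])
    have "M $$ (j, j) \<noteq> 0" using positive_not_zero[OF M(3)[OF less.prems]] .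
    then show ?case using ent d[OF less.prems] unfolding jj by simp
  qed
  show "L = M"
    using cols L(1) M(1) by (intro eq_matI) auto
qed

text \<open>Induction on the size: the factor \<open>K\<close> of the leading block is bordered by a
  row \<open>x\<close>, which solves a linear system for the last column of \<open>A\<close>, and by
  a corner \<open>r\<close>. The Schur complement \<open>m\<close> must equal
  \<open>r\<^sup>2 * ?d n\<close>. Comparing determinants gives \<open>m\<close> the quadratic
  character of \<open>?d n\<close>, so a positive \<open>r\<close> exists.\<close>

lemma cholesky_sign_diag_surj:
  assumes "A \<in> (LPM n \<epsilon> :: 'a mat set)" "\<And>k. k \<in> {1..n} \<Longrightarrow> \<epsilon> k \<in> {1, -1}"
  shows "\<exists>L\<in>pos_lower n. cholesky (mat_diag n (sign_entry \<epsilon>)) L = A"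
  using assms
proof (induction n arbitrary: A)
  case 0
  then have "A \<in> carrier_mat 0 0" by (simp add: LPM_def)
  then show ?case
    by (intro bexI[of _ A]) (auto simp: pos_lower_def cholesky_def)
next
  case (Suc n)
  let ?d = "sign_entry \<epsilon> :: nat \<Rightarrow> 'a"
  have A: "A \<in> carrier_mat (Suc n) (Suc n)" "transpose_mat A = A"
    and minors: "\<And>k. k \<in> {1..Suc n} \<Longrightarrow> quad_char (det (lead k A)) = \<epsilon> k"
    using Suc.prems(1) by (auto simp: LPM_iff)
  have sym: "A $$ (j, i) = A $$ (i, j)" if "i < Suc n" "j < Suc n" for i j
    using arg_cong[OF A(2), of "\<lambda>X. X $$ (i, j)"] A(1) that by simp
  have "transpose_mat (lead n A) = lead n A"
    by (intro eq_matI) (simp_all add: sym)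
  then have "lead n A \<in> LPM n \<epsilon>"
    using minors by (simp add: LPM_iff lead_lead)
  then obtain K where K: "K \<in> pos_lower n" "cholesky (mat_diag n ?d) K = lead n A"
    using Suc.IH[of "lead n A"] Suc.prems(2) by auto
  note Kc = pos_lowerD[OF K(1)]
  have KD: "K * mat_diag n ?d \<in> carrier_mat n n" using Kc(1) by simp
  have "det (K * mat_diag n ?d) = det K * (\<Prod>i<n. ?d i)"
    using Kc(1) by (simp add: det_mult[of K n] det_mat_diag)
  then have "det (K * mat_diag n ?d) \<noteq> 0"
    using positive_not_zero[OF det_pos_lower[OF K(1)]] sign_entry_nonzero by simp
  then obtain C where C: "C \<in> carrier_mat n n" "K * mat_diag n ?d * C = 1\<^sub>m n"
    using obtain_inverse_mat[OF KD] by blast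
  define x where "x i = (\<Sum>a<n. C $$ (i, a) * A $$ (a, n))" for i
  have solves: "(\<Sum>a<n. K $$ (i, a) * ?d a * x a) = A $$ (i, n)" if "i < n" for i
  proof -
    have KDi: "(K * mat_diag n ?d) $$ (i, a) = K $$ (i, a) * ?d a" if "a < n" for a
      using Kc(1) \<open>i < n\<close> that by (simp add: mat_diag_mult_right[of K n n])
    have "(\<Sum>a<n. K $$ (i, a) * ?d a * x a)
        = (\<Sum>b<n. (\<Sum>a<n. K $$ (i, a) * ?d a * C $$ (a, b)) * A $$ (b, n))"
      unfolding x_def sum_distrib_left sum_distrib_right by (subst sum.swap) (simp add: mult.assoc)
    also have "\<dots> = (\<Sum>b<n. 1\<^sub>m n $$ (i, b) * A $$ (b, n))"
    proof (rule sum.cong[OF refl])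
      fix b assume "b \<in> {..<n}"
      then have "1\<^sub>m n $$ (i, b) = (\<Sum>a<n. (K * mat_diag n ?d) $$ (i, a) * C $$ (a, b))"
        using mult_mat_index[OF KD C(1) that, of b] unfolding C(2) by simp
      then show "(\<Sum>a<n. K $$ (i, a) * ?d a * C $$ (a, b)) * A $$ (b, n) = 1\<^sub>m n $$ (i, b) * A $$ (b, n)"
        by (simp add: KDi)
    qed
    also have "\<dots> = (\<Sum>b<n. if b = i then A $$ (i, n) else 0)"
      using that by (intro sum.cong) auto
    also have "\<dots> = A $$ (i, n)" using that by simp
    finally show ?thesis .
  qed
  define m where "m = A $$ (n, n) - (\<Sum>a<n. x a * ?d a * x a)"
  define ext where "ext r = mat (Suc n) (Suc n)
    (\<lambda>(i, j). if i < n then (if j < n then K $$ (i, j) else 0) else if j < n then x j else r)" for r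
  have ext_pos: "ext r \<in> pos_lower (Suc n)" if "r \<in> positives" for r
  proof -
    have "ext r $$ (i, j) = 0" if "i < Suc n" "j < Suc n" "i < j" for i j
      using that Kc(2)[of i j] by (auto simp: ext_def)
    moreover have "ext r $$ (i, i) \<in> positives" if "i < Suc n" for i
      using that Kc(3)[of i] \<open>r \<in> positives\<close> by (auto simp: ext_def)
    moreover have "ext r \<in> carrier_mat (Suc n) (Suc n)" by (simp add: ext_def)
    ultimately show ?thesis unfolding pos_lower_def by blast
  qed
  \<comment> \<open>The last diagonal entry \<open>e\<close> stays free: \<open>r = 1\<close> and
    \<open>e = m\<close> serve to compute \<open>det A\<close>, and \<open>e = ?d n\<close> with the
    final \<open>r\<close> gives the factorization.\<close>
  have ext_cholesky: "cholesky (mat_diag (Suc n) (\<lambda>i. if i < n then ?d i else e)) (ext r) = A"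
    if "r\<^sup>2 * e = m" for r e
  proof (rule eq_matI)
    let ?e = "\<lambda>i. if i < n then ?d i else e"
    fix i j assume "i < dim_row A" "j < dim_col A"
    then have ij: "i < Suc n" "j < Suc n" using A(1) by auto
    have ec: "ext r \<in> carrier_mat (Suc n) (Suc n)" by (simp add: ext_def)
    have eq: "cholesky (mat_diag (Suc n) ?e) (ext r) $$ (i, j)
      = (\<Sum>a<n. ext r $$ (i, a) * ?d a * ext r $$ (j, a)) + ext r $$ (i, n) * e * ext r $$ (j, n)"
      unfolding cholesky_diag_index[OF ec ij] by simp
    consider "i < n" "j < n" | "i < n" "j = n" | "i = n" "j < n" | "i = n" "j = n"
      using ij by linarith
    then show "cholesky (mat_diag (Suc n) ?e) (ext r) $$ (i, j) = A $$ (i, j)"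
    proof cases
      case 1
      then have "A $$ (i, j) = cholesky (mat_diag n ?d) K $$ (i, j)" unfolding K(2) by simp
      also have "\<dots> = (\<Sum>a<n. K $$ (i, a) * ?d a * K $$ (j, a))"
        by (rule cholesky_diag_index[OF Kc(1) 1])
      finally show ?thesis unfolding eq using 1 by (simp add: ext_def)
    next
      case 2
      then show ?thesis unfolding eq using solves[of i] by (simp add: ext_def)
    next
      case 3
      then show ?thesis unfolding eq using solves[of j] sym[of j n]
        by (simp add: ext_def mult.commute mult.left_commute)
    next
      case 4
      then show ?thesis unfolding eq using that by (simp add: ext_def m_def power2_eq_square algebra_simps)
    qed
  qed (use A(1) in \<open>simp_all add: cholesky_def ext_def mat_diag_def\<close>)
  let ?P = "\<Prod>i<n. ?d i"
  have e1: "(\<Prod>i<Suc n. if i < n then ?d i else m) = ?P * m" by simp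
  have "det A = (det (ext 1))\<^sup>2 * (?P * m)"
  proof -
    have "det (cholesky (mat_diag (Suc n) (\<lambda>i. if i < n then ?d i else m)) (ext 1))
        = (det (ext 1))\<^sup>2 * det (mat_diag (Suc n) (\<lambda>i. if i < n then ?d i else m))"
      by (rule det_cholesky[of _ "Suc n"]) (simp_all add: ext_def)
    then show ?thesis using ext_cholesky[of 1 m] by (simp only: det_mat_diag e1) simp
  qed
  moreover have "det (ext 1) \<noteq> 0"
    by (intro positive_not_zero det_pos_lower[of _ "Suc n"] ext_pos) simp
  ultimately have "quad_char (det A) = quad_char (?P * m)"
    by (simp add: quad_char_positive_mult square_positive)
  moreover have "quad_char (det A) = \<epsilon> (Suc n)" using minors[of "Suc n"] lead_self[OF A(1)] by simp
  moreover have "quad_char (?P * ?d n) = \<epsilon> (Suc n)"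
  proof -
    have "?P * ?d n = sign_elt \<epsilon> (Suc n)"
      using prod_sign_entry[of \<epsilon> n] by simp
    then show ?thesis using quad_char_sign_elt[of \<epsilon> "Suc n"] Suc.prems(2)[of "Suc n"] by simp
  qed
  \<comment> \<open>Both products have character \<open>\<epsilon> (Suc n)\<close>:
    \<open>?P * m\<close> through \<open>det A\<close>, and \<open>?P * ?d n\<close> by
    telescoping.\<close>
  ultimately have "quad_char ?P * quad_char m = quad_char ?P * quad_char (?d n)"
    by (simp only: quad_char_mult)
  moreover have "quad_char ?P \<noteq> 0"
    using sign_entry_nonzero by (simp add: quad_char_def)
  ultimately have "quad_char m = quad_char (?d n)" by (simp only: mult_cancel_left) simp
  then have "quad_char (?d n * m) = (quad_char (?d n))\<^sup>2"
    by (simp add: quad_char_mult power2_eq_square)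
  also have "\<dots> = 1" using sign_entry_nonzero[of \<epsilon> n] by (simp add: quad_char_def)
  finally have "?d n * m \<in> positives" by (simp only: quad_char_eq_1_iff)
  moreover have "m / ?d n = ?d n * m / (?d n)\<^sup>2"
    using sign_entry_nonzero[of \<epsilon> n] by (simp add: power2_eq_square)
  ultimately have "m / ?d n \<in> positives"
    using square_positive[OF sign_entry_nonzero[of \<epsilon> n]] by (simp add: positives_divide_iff)
  then have "\<exists>r. r \<in> positives \<and> r\<^sup>2 = m / ?d n" by (rule ex1_implies_ex[OF ex1_positive_sqrt])
  then obtain r where r: "r \<in> positives" "r\<^sup>2 = m / ?d n" by blast
  then have "r\<^sup>2 * ?d n = m" using sign_entry_nonzero[of \<epsilon> n] by simp
  then have "cholesky (mat_diag (Suc n) (\<lambda>i. if i < n then ?d i else ?d n)) (ext r) = A"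
    by (rule ext_cholesky)
  moreover have "mat_diag (Suc n) (\<lambda>i. if i < n then ?d i else ?d n) = mat_diag (Suc n) ?d"
    by (intro eq_matI) (auto simp: mat_diag_def less_Suc_eq)
  ultimately show ?case using ext_pos[OF r(1)] by auto
qed

text \<open>Factoring the base point as \<open>B = cholesky D M\<close> with \<open>D\<close> diagonal turns \<open>cholesky B\<close> into
  \<open>cholesky D\<close> after right multiplication by \<open>M\<close>, an injective self-map of a finite set.\<close>

lemma cholesky_bij:
  assumes B: "B \<in> (LPM n \<epsilon> :: 'a mat set)" and \<epsilon>: "\<And>k. k \<in> {1..n} \<Longrightarrow> \<epsilon> k \<in> {1, -1}"
  shows "bij_betw (cholesky B) (pos_lower n) (LPM n \<epsilon>)"
proof -
  define D where "D = (mat_diag n (sign_entry \<epsilon>) :: 'a mat)"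
  have D: "D \<in> carrier_mat n n" by (simp add: D_def)
  have injD: "inj_on (cholesky D) (pos_lower n)"
    unfolding D_def by (intro cholesky_diag_inj sign_entry_nonzero)
  have surjD: "\<exists>L\<in>pos_lower n. cholesky D L = A" if "A \<in> LPM n \<epsilon>" for A
    unfolding D_def using cholesky_sign_diag_surj[OF that \<epsilon>] .
  obtain M where M: "M \<in> pos_lower n" "cholesky D M = B" using surjD[OF B] by (elim bexE)
  have Mc: "M \<in> carrier_mat n n" by (rule pos_lowerD(1)[OF M(1)])
  have injM: "inj_on (\<lambda>L. L * M) (pos_lower n)"
  proof (rule inj_onI)
    fix L L' assume L: "L \<in> pos_lower n" "L' \<in> pos_lower n" "L * M = L' * M"
    obtain C where C: "C \<in> carrier_mat n n" "M * C = 1\<^sub>m n"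
      using obtain_inverse_mat[OF Mc positive_not_zero[OF det_pos_lower[OF M(1)]]] by blast
    have cancel: "X * M * C = X" if "X \<in> pos_lower n" for X
      using pos_lowerD(1)[OF that] by (simp add: assoc_mult_mat[OF _ Mc C(1)] C(2))
    have "L * M * C = L' * M * C" by (simp only: L(3))
    then show "L = L'" unfolding cancel[OF L(1)] cancel[OF L(2)] .
  qed
  have imM: "(\<lambda>L. L * M) ` pos_lower n = pos_lower n"
    by (rule endo_inj_surj[OF finite_pos_lower _ injM]) (intro image_subsetI mult_pos_lower M(1))
  have eq: "cholesky B L = cholesky D (L * M)" if "L \<in> pos_lower n" for L
    unfolding M(2)[symmetric] by (rule cholesky_mult[OF D pos_lowerD(1)[OF that] Mc])
  show ?thesis
    unfolding bij_betw_def
  proof (intro conjI inj_onI equalityI subsetI)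
    fix L L' assume L: "L \<in> pos_lower n" "L' \<in> pos_lower n" "cholesky B L = cholesky B L'"
    have "L * M = L' * M"
      using L(3) unfolding eq[OF L(1)] eq[OF L(2)]
      by (rule inj_onD[OF injD]) (intro mult_pos_lower L M)+
    then show "L = L'" by (rule inj_onD[OF injM _ L(1,2)])
  next
    fix A assume "A \<in> cholesky B ` pos_lower n"
    then show "A \<in> LPM n \<epsilon>" by (elim imageE) (simp add: cholesky_LPM[OF B])
  next
    fix A assume A: "A \<in> (LPM n \<epsilon> :: 'a mat set)"
    obtain K where K: "K \<in> pos_lower n" "cholesky D K = A" using surjD[OF A] by (elim bexE)
    have "K \<in> (\<lambda>L. L * M) ` pos_lower n" unfolding imM by (rule K(1))
    then obtain L where L: "K = L * M" "L \<in> pos_lower n" by (rule imageE)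
    have "cholesky B L = A" unfolding eq[OF L(2)] L(1)[symmetric] by (rule K(2))
    then show "A \<in> cholesky B ` pos_lower n" using L(2) by (rule image_eqI[OF sym])
  qed
qed

end

section \<open>Field automorphisms\<close>

lemma frob_funpow: "(frob p ^^ l) x = x ^ (p ^ l)"
  by (induction l) (simp_all add: frob_def power_mult[symmetric] mult.commute)

lemma frob_funpow_hom: "comm_ring_hom (frob CHAR('a) ^^ l :: 'a::finite_field \<Rightarrow> 'a)"
  by unfold_locales
     (simp_all add: frob_funpow power_mult_distrib freshmans_dream'[OF CHAR_prime refl] power_0_left)

lemma smult_cholesky:
  assumes "B \<in> carrier_mat n n" "L \<in> carrier_mat n n"
  shows "cholesky (c \<cdot>\<^sub>m B) L = c \<cdot>\<^sub>m cholesky B L"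
proof -
  have "transpose_mat L \<in> carrier_mat n n" using assms(2) by simp
  then show ?thesis unfolding cholesky_def
    using assms by (simp add: mult_smult_distrib mult_smult_assoc_mat[of _ n n _ n])
qed

lemma cholesky_smult:
  assumes "B \<in> carrier_mat n n" "L \<in> carrier_mat n n"
  shows "cholesky B (r \<cdot>\<^sub>m L) = r\<^sup>2 \<cdot>\<^sub>m cholesky B L"
proof (rule eq_matI)
  fix i j assume "i < dim_row (r\<^sup>2 \<cdot>\<^sub>m cholesky B L)" "j < dim_col (r\<^sup>2 \<cdot>\<^sub>m cholesky B L)"
  then have ij: "i < n" "j < n" using assms by (simp_all add: cholesky_def)
  have rL: "r \<cdot>\<^sub>m L \<in> carrier_mat n n" using assms by simp
  have "cholesky B (r \<cdot>\<^sub>m L) $$ (i, j)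
      = (\<Sum>b<n. (\<Sum>a<n. r * L $$ (i, a) * B $$ (a, b)) * (r * L $$ (j, b)))"
    unfolding cholesky_index[OF assms(1) rL ij] using ij assms by simp
  also have "\<dots> = r\<^sup>2 * cholesky B L $$ (i, j)"
    unfolding cholesky_index[OF assms ij]
    by (simp add: sum_distrib_left sum_distrib_right power2_eq_square algebra_simps)
  finally show "cholesky B (r \<cdot>\<^sub>m L) $$ (i, j) = (r\<^sup>2 \<cdot>\<^sub>m cholesky B L) $$ (i, j)"
    using ij assms by (simp add: cholesky_def)
qed (use assms in \<open>simp_all add: cholesky_def\<close>)

lemma hom_cholesky:
  assumes "comm_ring_hom \<phi>" "B \<in> carrier_mat n n" "L \<in> carrier_mat n n"
  shows "map_mat \<phi> (cholesky B L) = cholesky (map_mat \<phi> B) (map_mat \<phi> L)"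
proof -
  interpret comm_ring_hom \<phi> by fact
  have T: "transpose_mat L \<in> carrier_mat n n" "L * B \<in> carrier_mat n n" using assms by simp_all
  have "map_mat \<phi> (transpose_mat L) = transpose_mat (map_mat \<phi> L)"
    by (intro eq_matI) simp_all
  then show ?thesis
    unfolding cholesky_def mat_hom_mult[OF T(2,1)] mat_hom_mult[OF assms(3,2)] by simp
qed

lemma map_mat_scaled: "map_mat (\<lambda>x. c * \<phi> x) A = c \<cdot>\<^sub>m map_mat \<phi> A"
  by (intro eq_matI) simp_all

lemma det_2:
  fixes A :: "'a::comm_ring_1 mat"
  assumes A: "A \<in> carrier_mat 2 2"
  shows "det A = A $$ (0, 0) * A $$ (1, 1) - A $$ (0, 1) * A $$ (1, 0)"
proof -
  have "{..<2::nat} = {0, 1}" by auto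
  then have "det A = A $$ (0, 0) * cofactor A 0 0 + A $$ (0, 1) * cofactor A 0 1"
    using laplace_expansion_row[OF A, of 0] by simp
  moreover have "cofactor A 0 0 = A $$ (1, 1)" "cofactor A 0 1 = - A $$ (1, 0)"
    using A by (simp_all add: cofactor_def det_single mat_delete_def)
  ultimately show ?thesis by simp
qed

context definite_field
begin

text \<open>Homomorphisms preserve the equation in Euler's criterion; for negative \<open>x\<close>
  this is applied to \<open>- x\<close>.\<close>

lemma hom_positive_iff:
  assumes "comm_ring_hom (\<phi> :: 'a \<Rightarrow> 'a)" shows "\<phi> x \<in> positives \<longleftrightarrow> x \<in> positives"
proof -
  interpret comm_ring_hom \<phi> by fact
  have pos: "\<phi> y \<in> positives" if "y \<in> positives" for y
    using that hom_power[of y half] by (simp add: positives_iff)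
  show ?thesis
  proof (cases "x = 0 \<or> x \<in> positives")
    case False
    then have "- x \<in> positives" using uminus_positive_iff[of x] by simp
    then have "- \<phi> x \<in> positives" using pos[of "- x"] by (simp add: hom_uminus)
    then have "\<phi> x \<notin> positives"
      using uminus_positive_iff[of "\<phi> x"] positive_not_zero[of "\<phi> x"] by auto
    then show ?thesis using False by simp
  qed (auto simp: pos)
qed

text \<open>Makes \<open>inv_into UNIV\<close> a true inverse of the scaled homomorphism.\<close>

lemma scaled_hom_bij:
  assumes "comm_ring_hom (\<phi> :: 'a \<Rightarrow> 'a)" "c \<noteq> 0" shows "bij (\<lambda>x. c * \<phi> x)"
proof -
  interpret comm_ring_hom \<phi> by fact
  have nz: "\<phi> x \<noteq> 0" if "x \<noteq> 0" for x
  proof -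
    have "\<phi> x * \<phi> (inverse x) = 1" using that by (simp add: hom_mult[symmetric])
    then show ?thesis by auto
  qed
  have "inj (\<lambda>x. c * \<phi> x)"
  proof (rule injI)
    fix x y assume "c * \<phi> x = c * \<phi> y"
    then have "\<phi> (x - y) = 0" using assms(2) by (simp add: hom_minus)
    then show "x = y" using nz[of "x - y"] by auto
  qed
  then show ?thesis by (simp add: bij_def finite_UNIV_inj_surj)
qed

lemma quad_char_scaled_hom:
  assumes "comm_ring_hom (\<phi> :: 'a \<Rightarrow> 'a)" "c \<in> positives"
  shows "quad_char (c * \<phi> x) = quad_char x"
proof -
  have "c * \<phi> x = c * \<phi> 0 \<longleftrightarrow> x = 0"
    using inj_eq[OF bij_is_inj[OF scaled_hom_bij[OF assms(1) positive_not_zero[OF assms(2)]]], of x 0] .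
  moreover have "\<phi> 0 = 0"
  proof -
    interpret comm_ring_hom \<phi> by fact
    show ?thesis by simp
  qed
  ultimately have "\<phi> x = 0 \<longleftrightarrow> x = 0" using positive_not_zero[OF assms(2)] by simp
  then show ?thesis
    using hom_positive_iff[OF assms(1), of x] by (simp add: quad_char_positive_mult assms(2)) (simp add: quad_char_def)
qed

text \<open>The \<open>k\<close>-th leading minor becomes \<open>c ^ k\<close> times its image under
  \<open>\<phi>\<close>, with the same quadratic character. The direction from the image back to
  \<open>A\<close> serves to pull base points back and to compare the two sign patterns.\<close>

lemma scaled_hom_LPM_iff:
  assumes \<phi>: "comm_ring_hom (\<phi> :: 'a \<Rightarrow> 'a)" and c: "c \<in> positives" and A: "A \<in> carrier_mat n n"
  shows "map_mat (\<lambda>x. c * \<phi> x) A \<in> LPM n \<epsilon> \<longleftrightarrow> A \<in> LPM n \<epsilon>"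
proof -
  let ?h = "\<lambda>x. c * \<phi> x"
  interpret comm_ring_hom \<phi> by fact
  have inj: "inj ?h" using scaled_hom_bij[OF \<phi> positive_not_zero[OF c]] by (rule bij_is_inj)
  have "quad_char (det (lead k (map_mat ?h A))) = quad_char (det (lead k A))" if "k \<le> n" for k
  proof -
    have "lead k (map_mat ?h A) = c \<cdot>\<^sub>m map_mat \<phi> (lead k A)"
      using A that by (intro eq_matI) simp_all
    then have "det (lead k (map_mat ?h A)) = c ^ k * \<phi> (det (lead k A))" by simp
    then show ?thesis using quad_char_scaled_hom[OF \<phi> positives_power[OF c]] by simp
  qed
  moreover have "transpose_mat (map_mat ?h A) = map_mat ?h A \<longleftrightarrow> transpose_mat A = A"
  proof
    assume eq: "transpose_mat (map_mat ?h A) = map_mat ?h A"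
    show "transpose_mat A = A"
    proof (rule eq_matI)
      fix i j assume ij: "i < dim_row A" "j < dim_col A"
      then have "?h (A $$ (j, i)) = ?h (A $$ (i, j))"
        using arg_cong[OF eq, of "\<lambda>X. X $$ (i, j)"] A by simp
      then have "A $$ (j, i) = A $$ (i, j)" by (rule injD[OF inj])
      then show "transpose_mat A $$ (i, j) = A $$ (i, j)" using ij A by simp
    qed (use A in auto)
  next
    assume eq: "transpose_mat A = A"
    have "transpose_mat (map_mat ?h A) = map_mat ?h (transpose_mat A)"
      by (intro eq_matI) simp_all
    then show "transpose_mat (map_mat ?h A) = map_mat ?h A" unfolding eq .
  qed
  ultimately show ?thesis using A by (simp add: LPM_iff)
qed

lemma hom_pos_lower:
  assumes "comm_ring_hom (\<phi> :: 'a \<Rightarrow> 'a)" "L \<in> pos_lower n"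
  shows "map_mat \<phi> L \<in> pos_lower n"
proof -
  interpret comm_ring_hom \<phi> by fact
  show ?thesis
    using pos_lowerD[OF assms(2)] by (auto simp: pos_lower_def hom_positive_iff[OF assms(1)])
qed

lemma smult_pos_lower:
  assumes "r \<in> positives" "L \<in> (pos_lower n :: 'a mat set)"
  shows "r \<cdot>\<^sub>m L \<in> pos_lower n"
  using pos_lowerD[OF assms(2)] assms(1) by (auto simp: pos_lower_def positives_mult_iff)

section \<open>Inverse Cholesky maps under scaled automorphisms, and prescribed leading
  blocks\<close>

lemma cholesky_inv_cholesky:
  assumes "B \<in> (LPM n \<epsilon> :: 'a mat set)" "\<And>k. k \<in> {1..n} \<Longrightarrow> \<epsilon> k \<in> {1, -1}" "L \<in> pos_lower n"
  shows "cholesky_inv n B (cholesky B L) = L"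
  unfolding cholesky_inv_def
  using bij_betw_imp_inj_on[OF cholesky_bij[OF assms(1,2)]] assms(3) by (rule inv_into_f_f)

lemma cholesky_cholesky_inv:
  assumes "B \<in> (LPM n \<epsilon> :: 'a mat set)" "\<And>k. k \<in> {1..n} \<Longrightarrow> \<epsilon> k \<in> {1, -1}" "A \<in> LPM n \<epsilon>"
  shows "cholesky_inv n B A \<in> pos_lower n" "cholesky B (cholesky_inv n B A) = A"
proof -
  have "A \<in> cholesky B ` pos_lower n"
    using bij_betw_imp_surj_on[OF cholesky_bij[OF assms(1,2)]] assms(3) by simp
  then show "cholesky_inv n B A \<in> pos_lower n" "cholesky B (cholesky_inv n B A) = A"
    unfolding cholesky_inv_def by (rule inv_into_into, rule f_inv_into_f)
qed

text \<open>The base point is the preimage \<open>C\<close> of \<open>B\<close>, since applying the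
  scaled automorphism to \<open>cholesky C L = A\<close> has to produce a factorization over
  \<open>B\<close>. A factor \<open>r\<close> on the triangular side comes out squared.\<close>

lemma cholesky_inv_hom:
  assumes \<phi>: "comm_ring_hom (\<phi> :: 'a \<Rightarrow> 'a)" and c: "c \<in> positives" and r: "r \<in> positives"
    and \<epsilon>: "\<And>k. k \<in> {1..n} \<Longrightarrow> \<epsilon> k \<in> {1, -1}"
    and A: "A \<in> LPM n \<epsilon>" and B: "B \<in> LPM n \<epsilon>"
  shows "cholesky_inv n B ((r\<^sup>2 * c) \<cdot>\<^sub>m map_mat \<phi> A)
    = r \<cdot>\<^sub>m map_mat \<phi> (cholesky_inv n (map_mat (inv_into UNIV (\<lambda>x. c * \<phi> x)) B) A)"
proof -
  let ?h = "\<lambda>x. c * \<phi> x"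
  define C where "C = map_mat (inv_into UNIV ?h) B"
  define L where "L = cholesky_inv n C A"
  have Bc: "B \<in> carrier_mat n n" using B by (simp add: LPM_def)
  then have Cc: "C \<in> carrier_mat n n" by (simp add: C_def)
  have "surj ?h" using scaled_hom_bij[OF \<phi> positive_not_zero[OF c]] by (rule bij_is_surj)
  then have hC: "map_mat ?h C = B"
    by (intro eq_matI) (simp_all add: C_def surj_f_inv_f[of ?h])
  then have C: "C \<in> LPM n \<epsilon>" using scaled_hom_LPM_iff[OF \<phi> c Cc] B by simp
  have L: "L \<in> pos_lower n" "cholesky C L = A"
    unfolding L_def using cholesky_cholesky_inv[OF C \<epsilon> A] by simp_all
  have Lc: "L \<in> carrier_mat n n" "map_mat \<phi> L \<in> carrier_mat n n" "map_mat \<phi> C \<in> carrier_mat n n"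
    using pos_lowerD(1)[OF L(1)] Cc by simp_all
  have "(r\<^sup>2 * c) \<cdot>\<^sub>m map_mat \<phi> A = r\<^sup>2 \<cdot>\<^sub>m (c \<cdot>\<^sub>m map_mat \<phi> (cholesky C L))"
    unfolding L(2) by (intro eq_matI) simp_all
  also have "c \<cdot>\<^sub>m map_mat \<phi> (cholesky C L) = cholesky (c \<cdot>\<^sub>m map_mat \<phi> C) (map_mat \<phi> L)"
    unfolding hom_cholesky[OF \<phi> Cc Lc(1)] smult_cholesky[OF Lc(3,2)] ..
  also have "c \<cdot>\<^sub>m map_mat \<phi> C = B" using hC by (simp add: map_mat_scaled)
  also have "r\<^sup>2 \<cdot>\<^sub>m cholesky B (map_mat \<phi> L) = cholesky B (r \<cdot>\<^sub>m map_mat \<phi> L)"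
    using cholesky_smult[OF Bc Lc(2)] by simp
  finally have "(r\<^sup>2 * c) \<cdot>\<^sub>m map_mat \<phi> A = cholesky B (r \<cdot>\<^sub>m map_mat \<phi> L)" .
  then have "cholesky_inv n B ((r\<^sup>2 * c) \<cdot>\<^sub>m map_mat \<phi> A) = r \<cdot>\<^sub>m map_mat \<phi> L"
    using cholesky_inv_cholesky[OF B \<epsilon> smult_pos_lower[OF r hom_pos_lower[OF \<phi> L(1)]]] by simp
  then show ?thesis unfolding L_def C_def .
qed

text \<open>The triangular factor has leading rows \<open>(u, 0)\<close> and \<open>(v, w)\<close>
  with \<open>u\<^sup>2 = a\<close>, \<open>u * v = b\<close> and
  \<open>v\<^sup>2 + w\<^sup>2 = c\<close>, solvable because \<open>a\<close> and the minor are
  positive. The first two rows see only the first two diagonal signs, both 1.\<close>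

lemma LPM_with_leading_block:
  assumes n: "2 \<le> n" and \<epsilon>: "\<And>k. k \<in> {1..n} \<Longrightarrow> \<epsilon> k \<in> {1, -1}" "\<epsilon> 1 = 1" "\<epsilon> 2 = 1"
    and a: "a \<in> positives" and minor: "a * c - b\<^sup>2 \<in> (positives :: 'a set)"
  shows "\<exists>A\<in>LPM n \<epsilon>. A $$ (0, 0) = a \<and> A $$ (0, 1) = b \<and> A $$ (1, 0) = b \<and> A $$ (1, 1) = c"
proof -
  define u where "u = pos_sqrt a"
  define w where "w = pos_sqrt (a * c - b\<^sup>2) / u"
  define v where "v = b / u"
  have u: "u \<in> positives" "u\<^sup>2 = a" unfolding u_def using pos_sqrt[OF a] by simp_all
  have u0: "u \<noteq> 0" using positive_not_zero[OF u(1)] .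
  have w: "w \<in> positives"
    unfolding w_def using pos_sqrt(1)[OF minor] u(1) by (simp add: positives_divide_iff)
  have "w\<^sup>2 = (a * c - b\<^sup>2) / a"
    unfolding w_def by (simp add: power_divide pos_sqrt(2)[OF minor] u(2))
  then have vw: "u * v = b" "v\<^sup>2 + w\<^sup>2 = c"
    using positive_not_zero[OF a] u0 unfolding v_def power_divide u(2)
    by (simp_all add: add_divide_distrib[symmetric])
  define L where "L = mat n n (\<lambda>(i, j). if i = 0 \<and> j = 0 then u else if i = 1 \<and> j = 0 then v
    else if i = 1 \<and> j = 1 then w else if i = j then 1 else 0)"
  have Lc: "L \<in> carrier_mat n n" by (simp add: L_def)
  have Lp: "L \<in> pos_lower n"
    using u(1) w unfolding pos_lower_def by (auto simp: L_def)
  define A where "A = cholesky (sign_diag n \<epsilon>) L"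
  have A: "A \<in> LPM n \<epsilon>" unfolding A_def by (rule cholesky_LPM[OF sign_diag_LPM[OF \<epsilon>(1)] Lp])
  have "A $$ (i, j) = L $$ (i, 0) * L $$ (j, 0) + L $$ (i, 1) * L $$ (j, 1)" if "i < 2" "j < 2" for i j
  proof -
    have "A $$ (i, j) = (\<Sum>a<n. L $$ (i, a) * sign_entry \<epsilon> a * L $$ (j, a))"
      unfolding A_def sign_diag_eq using that n by (intro cholesky_diag_index[OF Lc]) simp_all
    also have "\<dots> = (\<Sum>a<2. L $$ (i, a) * sign_entry \<epsilon> a * L $$ (j, a))"
      using that n by (intro sum.mono_neutral_right) (auto simp: L_def)
    also have "{..<2::nat} = {0, 1}" by auto
    finally show ?thesis using \<epsilon>(2,3) by (simp add: sign_entry_def sign_elt_def numeral_2_eq_2)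
  qed
  note entries = this[of 0 0] this[of 0 1] this[of 1 0] this[of 1 1]
  have "A $$ (0, 0) = a" "A $$ (0, 1) = b" "A $$ (1, 0) = b" "A $$ (1, 1) = c"
    using entries n u(2) vw by (simp_all add: L_def power2_eq_square mult.commute)
  then show ?thesis using A by blast
qed

lemma LPM_transform_minor:
  assumes n: "2 \<le> n"
    and \<epsilon>: "\<epsilon> 1 = 1" "\<epsilon> 2 = 1" and \<epsilon>': "\<And>k. k \<in> {1..n} \<Longrightarrow> \<epsilon>' k \<in> {1, -1}" "\<epsilon>' 1 = 1" "\<epsilon>' 2 = 1"
    and f: "map_mat f ` LPM n \<epsilon>' \<subseteq> (LPM n \<epsilon> :: 'a mat set)"
    and a: "a \<in> positives" and minor: "a * c - b\<^sup>2 \<in> (positives :: 'a set)"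
  shows "f a \<in> positives" "f a * f c - (f b)\<^sup>2 \<in> positives"
proof -
  obtain A where A: "A \<in> LPM n \<epsilon>'"
    and entries: "A $$ (0, 0) = a" "A $$ (0, 1) = b" "A $$ (1, 0) = b" "A $$ (1, 1) = c"
    using LPM_with_leading_block[OF n \<epsilon>' a minor] by blast
  define F where "F = map_mat f A"
  have F: "F \<in> LPM n \<epsilon>" using f A unfolding F_def by blast
  have Ac: "A \<in> carrier_mat n n" using A by (simp add: LPM_def)
  have minors: "quad_char (det (lead k F)) = \<epsilon> k" if "k \<in> {1..n}" for k
    using F that by (simp add: LPM_iff)
  have "det (lead 1 F) = f a"
    using Ac n entries by (simp add: det_single F_def)
  then show "f a \<in> positives" using minors[of 1] n \<epsilon>(1) by (simp add: quad_char_eq_1_iff)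
  have "det (lead 2 F) = f a * f c - (f b)\<^sup>2"
    using Ac n entries by (simp add: det_2 F_def power2_eq_square)
  then show "f a * f c - (f b)\<^sup>2 \<in> positives"
    using minors[of 2] n \<epsilon>(2) by (simp add: quad_char_eq_1_iff)
qed

end

section \<open>The equivalence and the Cholesky identities\<close>

theorem theorem2:
  fixes f :: "'a::finite_field \<Rightarrow> 'a"
    and s n p k :: nat
    and \<epsilon> \<epsilon>' :: "nat \<Rightarrow> int"
  assumes "2 \<le> s" and "s \<le> n"
    and "prime p" and "CARD('a) = p ^ k" and "CARD('a) mod 4 = 3"
    and "\<epsilon> \<in> sign_patterns n" and "\<epsilon>' \<in> sign_patterns n"
    and "\<forall>i\<in>{1..s}. \<epsilon> i = 1 \<and> \<epsilon>' i = 1"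
  shows
    "(map_mat f ` LPM n \<epsilon>' \<subseteq> LPM n \<epsilon> \<longleftrightarrow>
        \<epsilon>' = \<epsilon> \<and> (\<exists>l c. l \<le> k - 1 \<and> c \<in> positives \<and> f = (\<lambda>x. c * (frob p ^^ l) x)))
     \<and>
     (\<forall>c\<in>(positives :: 'a set). \<forall>l\<le>k - 1. \<forall>B\<in>LPM n \<epsilon>. \<forall>A\<in>LPM n \<epsilon>. \<forall>L\<in>pos_lower n.
        cholesky_inv n B (c \<cdot>\<^sub>m map_mat (frob p ^^ l) A)
          = map_mat (frob p ^^ l)
              (cholesky_inv n (map_mat (inv_into UNIV (\<lambda>x. c * (frob p ^^ l) x)) B) A) \<and>
        map_mat (frob p ^^ l)
              (cholesky_inv n (map_mat (inv_into UNIV (\<lambda>x. c * (frob p ^^ l) x)) B) A)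
          = pos_sqrt c \<cdot>\<^sub>m map_mat (frob p ^^ l)
              (cholesky_inv n (map_mat (inv_into UNIV (frob p ^^ l)) B) A) \<and>
        c \<cdot>\<^sub>m map_mat (frob p ^^ l) (cholesky B L)
          = cholesky (c \<cdot>\<^sub>m map_mat (frob p ^^ l) B) (map_mat (frob p ^^ l) L) \<and>
        cholesky (c \<cdot>\<^sub>m map_mat (frob p ^^ l) B) (map_mat (frob p ^^ l) L)
          = cholesky (map_mat (frob p ^^ l) B) (pos_sqrt c \<cdot>\<^sub>m map_mat (frob p ^^ l) L))
     \<and>
     (\<forall>M\<in>(pos_lower n :: 'a mat set).
        cholesky (sign_diag n \<epsilon>) (map_mat (frob p) M)
          = map_mat (frob p) (cholesky (sign_diag n \<epsilon>) M))
     \<and>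
     (\<forall>M\<in>(LPM n \<epsilon> :: 'a mat set).
        cholesky_inv n (sign_diag n \<epsilon>) (map_mat (frob p) M)
          = map_mat (frob p) (cholesky_inv n (sign_diag n \<epsilon>) M))"
proof -
  interpret definite_field "TYPE('a)" by unfold_locales (fact assms(5))
  have "CHAR('a) dvd p ^ k" using CHAR_dvd_CARD[where 'a = 'a] unfolding assms(4) .
  then have "CHAR('a) dvd p" by (rule prime_dvd_power[OF CHAR_prime])
  then have p: "p = CHAR('a)" using primes_dvd_imp_eq[of "CHAR('a)" p] assms(3) by simp
  have card: "CARD('a) = CHAR('a) ^ k" using assms(4) unfolding p .
  have n: "2 \<le> n" using assms(1,2) by simp
  have first: "\<epsilon> 1 = 1" "\<epsilon> 2 = 1" "\<epsilon>' 1 = 1" "\<epsilon>' 2 = 1" using assms(1,8) by auto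
  have \<epsilon>: "\<epsilon> i \<in> {1, -1}" and \<epsilon>': "\<epsilon>' i \<in> {1, -1}" if "i \<in> {1..n}" for i
    using that assms(6,7) by (auto simp: sign_patterns_def elim: PiE_mem)
  have hom: "comm_ring_hom (frob p ^^ l :: 'a \<Rightarrow> 'a)" for l unfolding p by (rule frob_funpow_hom)
  have LPMc: "A \<in> carrier_mat n n" if "A \<in> LPM n \<delta>" for A :: "'a mat" and \<delta>
    using that by (simp add: LPM_def)
  have char: "map_mat f ` LPM n \<epsilon>' \<subseteq> LPM n \<epsilon> \<longleftrightarrow>
        \<epsilon>' = \<epsilon> \<and> (\<exists>l c. l \<le> k - 1 \<and> c \<in> positives \<and> f = (\<lambda>x. c * (frob p ^^ l) x))"
    (is "?L \<longleftrightarrow> ?R")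
  proof
    assume f: ?L
    note minors = LPM_transform_minor[OF n first(1,2) \<epsilon>' first(3,4) f]
    \<comment> \<open>The block \<open>diag(a, 1)\<close> has determinant \<open>a\<close>.\<close>
    have fpos: "f a \<in> positives" if "a \<in> positives" for a
      using that by (intro minors(1)[of a 1 0]) simp_all
    obtain l where l: "l < k" "f = (\<lambda>x. f 1 * x ^ CHAR('a) ^ l)"
      using minor_preserver_is_frobenius_power[of k f, OF card fpos minors(2)] by auto
    have c: "f 1 \<in> positives" by (rule fpos) simp
    have f_eq: "f = (\<lambda>x. f 1 * (frob p ^^ l) x)" unfolding frob_funpow p by (rule l(2))
    \<comment> \<open>This sample matrix turns out to lie in both sets, so its minors make the
      patterns agree on \<open>{1..n}\<close>; extensionality makes them equal as functions.\<close>
    have D: "sign_diag n \<epsilon>' \<in> (LPM n \<epsilon>' :: 'a mat set)" by (rule sign_diag_LPM[OF \<epsilon>'])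
    then have "map_mat f (sign_diag n \<epsilon>') \<in> LPM n \<epsilon>" using f by blast
    then have "map_mat (\<lambda>x. f 1 * (frob p ^^ l) x) (sign_diag n \<epsilon>') \<in> LPM n \<epsilon>"
      using f_eq by simp
    then have "sign_diag n \<epsilon>' \<in> (LPM n \<epsilon> :: 'a mat set)"
      using scaled_hom_LPM_iff[OF hom c LPMc[OF D]] by blast
    then have "\<epsilon>' i = \<epsilon> i" if "i \<in> {1..n}" for i
      using D that by (simp add: LPM_def)
    then have "\<epsilon>' = \<epsilon>"
      using assms(6,7) unfolding sign_patterns_def by (intro PiE_ext) 
    moreover have "l \<le> k - 1" using l(1) by simp
    ultimately show ?R using c f_eq by blast
  next
    assume ?R
    then obtain l c where "\<epsilon>' = \<epsilon>" "c \<in> positives" "f = (\<lambda>x. c * (frob p ^^ l) x)" by blast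
    then show ?L using scaled_hom_LPM_iff[OF hom _ LPMc] by auto
  qed
  \<comment> \<open>The two formulas split \<open>c\<close> differently: scalar \<open>c\<close>
    with \<open>r = 1\<close>, and scalar 1 with \<open>r = pos_sqrt c\<close>.\<close>
  have inv: "cholesky_inv n B (c \<cdot>\<^sub>m map_mat (frob p ^^ l) A)
          = map_mat (frob p ^^ l)
              (cholesky_inv n (map_mat (inv_into UNIV (\<lambda>x. c * (frob p ^^ l) x)) B) A)"
    and inv_sqrt: "cholesky_inv n B (c \<cdot>\<^sub>m map_mat (frob p ^^ l) A)
          = pos_sqrt c \<cdot>\<^sub>m map_mat (frob p ^^ l)
              (cholesky_inv n (map_mat (inv_into UNIV (frob p ^^ l)) B) A)"
    if "c \<in> positives" "B \<in> LPM n \<epsilon>" "A \<in> LPM n \<epsilon>" for c :: 'a and l A B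
  proof -
    have "1 \<cdot>\<^sub>m X = X" for X :: "'a mat" by (intro eq_matI) simp_all
    then show "cholesky_inv n B (c \<cdot>\<^sub>m map_mat (frob p ^^ l) A)
          = map_mat (frob p ^^ l)
              (cholesky_inv n (map_mat (inv_into UNIV (\<lambda>x. c * (frob p ^^ l) x)) B) A)"
      using cholesky_inv_hom[OF hom that(1) one_positive \<epsilon> that(3,2), of l] by simp
    show "cholesky_inv n B (c \<cdot>\<^sub>m map_mat (frob p ^^ l) A)
          = pos_sqrt c \<cdot>\<^sub>m map_mat (frob p ^^ l)
              (cholesky_inv n (map_mat (inv_into UNIV (frob p ^^ l)) B) A)"
      using cholesky_inv_hom[OF hom one_positive pos_sqrt(1)[OF that(1)] \<epsilon> that(3,2), of l]
      by (simp add: pos_sqrt(2)[OF that(1)])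
  qed
  have fwd: "c \<cdot>\<^sub>m map_mat (frob p ^^ l) (cholesky B L)
          = cholesky (c \<cdot>\<^sub>m map_mat (frob p ^^ l) B) (map_mat (frob p ^^ l) L)"
    and fwd_sqrt: "cholesky (c \<cdot>\<^sub>m map_mat (frob p ^^ l) B) (map_mat (frob p ^^ l) L)
          = cholesky (map_mat (frob p ^^ l) B) (pos_sqrt c \<cdot>\<^sub>m map_mat (frob p ^^ l) L)"
    if "c \<in> positives" "B \<in> LPM n \<epsilon>" "L \<in> pos_lower n" for c :: 'a and l B L
  proof -
    have c: "B \<in> carrier_mat n n" "L \<in> carrier_mat n n"
      using LPMc[OF that(2)] pos_lowerD(1)[OF that(3)] by simp_all
    then have c': "map_mat (frob p ^^ l) B \<in> carrier_mat n n" "map_mat (frob p ^^ l) L \<in> carrier_mat n n"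
      by simp_all
    show "c \<cdot>\<^sub>m map_mat (frob p ^^ l) (cholesky B L)
          = cholesky (c \<cdot>\<^sub>m map_mat (frob p ^^ l) B) (map_mat (frob p ^^ l) L)"
      unfolding hom_cholesky[OF hom c] smult_cholesky[OF c'] ..
    show "cholesky (c \<cdot>\<^sub>m map_mat (frob p ^^ l) B) (map_mat (frob p ^^ l) L)
          = cholesky (map_mat (frob p ^^ l) B) (pos_sqrt c \<cdot>\<^sub>m map_mat (frob p ^^ l) L)"
      unfolding smult_cholesky[OF c'] cholesky_smult[OF c'] pos_sqrt(2)[OF that(1)] ..
  qed
  have D: "sign_diag n \<epsilon> \<in> (LPM n \<epsilon> :: 'a mat set)" by (rule sign_diag_LPM[OF \<epsilon>])
  have hom1: "comm_ring_hom (frob p :: 'a \<Rightarrow> 'a)" using hom[of 1] by simp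
  interpret frob: comm_ring_hom "frob p :: 'a \<Rightarrow> 'a" by (rule hom1)
  \<comment> \<open>The Frobenius fixes 1 and -1, hence this diagonal base point, which is therefore
    the same on both sides.\<close>
  have fixed: "frob p (sign_entry \<epsilon> i) = (sign_entry \<epsilon> i :: 'a)" for i
    by (simp add: sign_entry_def sign_elt_def frob.hom_mult frob.hom_uminus)
  have Dfix: "map_mat (frob p) (sign_diag n \<epsilon>) = (sign_diag n \<epsilon> :: 'a mat)"
    by (intro eq_matI) (simp_all add: sign_diag_eq mat_diag_def fixed)
  have sq: "cholesky (sign_diag n \<epsilon>) (map_mat (frob p) M)
          = map_mat (frob p) (cholesky (sign_diag n \<epsilon>) M)" if "M \<in> pos_lower n" for M :: "'a mat"
    using hom_cholesky[OF hom1 LPMc[OF D] pos_lowerD(1)[OF that]] unfolding Dfix by simp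
  have inv_frob: "cholesky_inv n (sign_diag n \<epsilon>) (map_mat (frob p) M)
          = map_mat (frob p) (cholesky_inv n (sign_diag n \<epsilon>) M)" if "M \<in> LPM n \<epsilon>" for M :: "'a mat"
  proof -
    note L = cholesky_cholesky_inv[OF D \<epsilon> that]
    have "map_mat (frob p) M = cholesky (sign_diag n \<epsilon>) (map_mat (frob p) (cholesky_inv n (sign_diag n \<epsilon>) M))"
      by (simp only: sq[OF L(1)] L(2))
    then show ?thesis
      using cholesky_inv_cholesky[OF D \<epsilon> hom_pos_lower[OF hom1 L(1)]] by (simp only:)
  qed
  have inv_eq: "map_mat (frob p ^^ l)
              (cholesky_inv n (map_mat (inv_into UNIV (\<lambda>x. c * (frob p ^^ l) x)) B) A)
          = pos_sqrt c \<cdot>\<^sub>m map_mat (frob p ^^ l)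
              (cholesky_inv n (map_mat (inv_into UNIV (frob p ^^ l)) B) A)"
    if "c \<in> positives" "B \<in> LPM n \<epsilon>" "A \<in> LPM n \<epsilon>" for c :: 'a and l A B
    by (rule trans[OF inv[OF that, symmetric] inv_sqrt[OF that]])
  show ?thesis
    by (intro conjI ballI allI impI)
       (rule char | (rule inv inv_eq fwd fwd_sqrt sq inv_frob; assumption))+
qed

end
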